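(* For every $n\ge1$, the number of $2$-row-restricted slicings of size $n$ equals the number of $0$-skinny slicings of size $n$.
   Context: Parallelogram polyominoes are edge-connected sets of unit cells bounded by two lattice paths with steps $(0,1)$ and $(1,0)$ meeting only at their endpoints. The size is $k+\ell-1$ for a $k\times\ell$ bounding rectangle. A Baxter slicing of size $n$ is such a polyomino $P$ of size $n$ divided into $n$ blocks, defined recursively: - for $n=1$, the single cell is the single block; - for $n\ge2$, one block is the topmost row (horizontal block) or the rightmost column (vertical block), and the other blocks form a Baxter slicing of the polyomino obtained by deleting it. A $2$-row-restricted slicing is a Baxter slicing all of whose horizontal blocks have width at most $2$. For a horizontal block $u$: - $\ell(u)$ is its width; - $X(u)$ is the lowest point of the lower border of $P$ with the abscissa of the right edge of $u$; - $r(u)$ is the number of horizontal steps of the lower border read leftwards from $X(u)$ before a vertical step or the bottom-left corner of $P$ is met. A $0$-skinny slicing is a Baxter slicing with $\ell(u)\le r(u)$ for every horizontal block $u$. *)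

theory Defs
  imports Main "HOL-Library.Sublist"
begin

text \<open>A cell \<open>(i, j)\<close> is the unit square with lower left corner \<open>(i, j)\<close>. Polyominoes are
  considered up to translation, so all paths start at the origin, which is the bottom left corner.\<close>

type_synonym cell = "nat \<times> nat"

datatype step = North | East

definition endpoint :: "step list \<Rightarrow> nat \<times> nat" where
  "endpoint p = (count_list p East, count_list p North)"

definition points :: "step list \<Rightarrow> (nat \<times> nat) set" where
  "points p = {endpoint q | q. prefix q p}"

definition horizontal_steps :: "step list \<Rightarrow> (nat \<times> nat) set" where
  \<comment> \<open>each horizontal step is given by its left end\<close>
  "horizontal_steps p = {endpoint q | q. prefix (q @ [East]) p}"

definition cells_between :: "step list \<Rightarrow> step list \<Rightarrow> cell set" where
  "cells_between L U =
     {(i, j). \<exists>a b. (i, a) \<in> horizontal_steps L \<and> (i, b) \<in> horizontal_steps U \<and> a \<le> j \<and> j < b}"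

text \<open>Non-emptiness excludes the two degenerate cases: \<open>L\<close> and \<open>U\<close> being the same path of
  length at most one, and \<open>L\<close> running above \<open>U\<close>.\<close>

definition bounded_by :: "step list \<Rightarrow> step list \<Rightarrow> cell set \<Rightarrow> bool" where
  "bounded_by L U P \<longleftrightarrow>
     endpoint L = endpoint U \<and> points L \<inter> points U = {(0, 0), endpoint L} \<and>
     P = cells_between L U \<and> P \<noteq> {}"

definition adjacent :: "cell \<Rightarrow> cell \<Rightarrow> bool" where
  "adjacent c d \<longleftrightarrow>
     fst c = fst d \<and> (snd d = Suc (snd c) \<or> snd c = Suc (snd d)) \<or>
     snd c = snd d \<and> (fst d = Suc (fst c) \<or> fst c = Suc (fst d))"

definition edge_connected :: "cell set \<Rightarrow> bool" where
  "edge_connected P \<longleftrightarrow>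
     (\<forall>c\<in>P. \<forall>d\<in>P. (c, d) \<in> {(a, b). a \<in> P \<and> b \<in> P \<and> adjacent a b}\<^sup>*)"

definition parallelogram_polyomino :: "cell set \<Rightarrow> bool" where
  "parallelogram_polyomino P \<longleftrightarrow> edge_connected P \<and> (\<exists>L U. bounded_by L U P)"

text \<open>The bounding paths are determined by the set of cells.\<close>

definition lower_border :: "cell set \<Rightarrow> step list" where
  "lower_border P = (THE L. \<exists>U. bounded_by L U P)"

definition width :: "cell set \<Rightarrow> nat" where
  "width A = Max (fst ` A) - Min (fst ` A) + 1"

definition height :: "cell set \<Rightarrow> nat" where
  "height A = Max (snd ` A) - Min (snd ` A) + 1"

definition psize :: "cell set \<Rightarrow> nat" where
  "psize P = width P + height P - 1"

definition top_row :: "cell set \<Rightarrow> cell set" where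
  "top_row P = {c \<in> P. snd c = Max (snd ` P)}"

definition right_column :: "cell set \<Rightarrow> cell set" where
  "right_column P = {c \<in> P. fst c = Max (fst ` P)}"

text \<open>The single block of the slicing of size 1 is neither horizontal nor vertical; calling it
  horizontal would not matter below, because it always has width 1 and \<open>r\<close>-value 1. In a
  polyomino of size at least 2 the top row and the right column differ, so the tags are
  determined by the underlying division into sets of cells.\<close>

datatype block = Single "cell set" | Horizontal "cell set" | Vertical "cell set"

text \<open>Deleting the top row (right column) may lower the size by more than one; such a deletion
  is not allowed, since \<open>baxter_slicing n P B\<close> implies \<open>psize P = n\<close>.\<close>

inductive baxter_slicing :: "nat \<Rightarrow> cell set \<Rightarrow> block set \<Rightarrow> bool" where
  single: "baxter_slicing 1 {(0, 0)} {Single {(0, 0)}}"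
| horizontal: "parallelogram_polyomino P \<Longrightarrow> psize P = Suc n \<Longrightarrow>
    baxter_slicing n (P - top_row P) B \<Longrightarrow>
    baxter_slicing (Suc n) P (insert (Horizontal (top_row P)) B)"
| vertical: "parallelogram_polyomino P \<Longrightarrow> psize P = Suc n \<Longrightarrow>
    baxter_slicing n (P - right_column P) B \<Longrightarrow>
    baxter_slicing (Suc n) P (insert (Vertical (right_column P)) B)"

definition row_restricted_slicings :: "nat \<Rightarrow> nat \<Rightarrow> (cell set \<times> block set) set" where
  "row_restricted_slicings m n =
     {(P, B). baxter_slicing n P B \<and> (\<forall>u. Horizontal u \<in> B \<longrightarrow> width u \<le> m)}"

definition foot :: "cell set \<Rightarrow> cell set \<Rightarrow> nat \<times> nat" where
  \<comment> \<open>the point \<open>X(u)\<close>\<close>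
  "foot P u = (let x = Suc (Max (fst ` u)) in (x, Min {y. (x, y) \<in> points (lower_border P)}))"

definition r_value :: "cell set \<Rightarrow> cell set \<Rightarrow> nat" where
  "r_value P u =
     length (takeWhile (\<lambda>s. s = East)
       (rev (THE q. prefix q (lower_border P) \<and> endpoint q = foot P u)))"

definition zero_skinny_slicings :: "nat \<Rightarrow> (cell set \<times> block set) set" where
  "zero_skinny_slicings n =
     {(P, B). baxter_slicing n P B \<and> (\<forall>u. Horizontal u \<in> B \<longrightarrow> width u \<le> r_value P u)}"

end

theory Submission
  imports Defs "HOL-Computational_Algebra.Formal_Power_Series"
begin

text \<open>
  Both families are counted by a generating tree. A polyomino in which the next row block may have
  width at most \<open>h\<close> and whose right column has height \<open>k\<close> gets the label \<open>(h, k)\<close>; a new row of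
  width \<open>w \<le> h\<close> leads to the label \<open>(w, k + 1)\<close>. A new column of height \<open>i \<le> k\<close> leads to \<open>(2, i)\<close>
  in the row-restricted family; in the skinny family it leads to \<open>(1, i)\<close> if \<open>i < k\<close>, but to
  \<open>(h + 1, k)\<close> if \<open>i = k\<close>, because then the lower border continues horizontally.

  Let \<open>W = X (1 + W) (1 + W + W\<^sup>2)\<close>, \<open>b = 1 + W\<close> and \<open>z = 1 + W + W\<^sup>2\<close>. The generating function of
  the descendants of a node labelled \<open>(h, k)\<close> is \<open>b\<^sup>h z\<^sup>k\<close> in the first tree and \<open>z\<^sup>h b\<^sup>k\<close> in the
  second one. The root has the label \<open>(1, 1)\<close>, and both expressions become \<open>b z\<close> there.
\<close>

section \<open>Lattice paths and bounding paths\<close>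

text \<open>A path is encoded by the heights of its East steps, one per column, so that geometric
  conditions become inequalities between list entries. North steps after the last East step leave no
  trace, hence the number of North steps is carried along separately.\<close>

fun east_heights :: "step list \<Rightarrow> nat list" where
  "east_heights [] = []"
| "east_heights (East # p) = 0 # east_heights p"
| "east_heights (North # p) = map Suc (east_heights p)"

lemma east_heights_append:
  "east_heights (p @ q) = east_heights p @ map (\<lambda>h. h + count_list p North) (east_heights q)"
  by (induction p rule: east_heights.induct) auto

lemma length_east_heights: "length (east_heights p) = count_list p East"
  by (induction p rule: east_heights.induct) auto

lemma east_heights_replicate_North [simp]: "east_heights (replicate m North) = []"
  by (induction m) auto

lemma count_list_replicate: "count_list (replicate m a) b = (if a = b then m else 0)"
  by (induction m) auto

lemma east_heights_le: "h \<in> set (east_heights p) \<Longrightarrow> h \<le> count_list p North"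
  by (induction p arbitrary: h rule: east_heights.induct) auto

lemma sorted_east_heights: "sorted (east_heights p)"
  by (induction p rule: east_heights.induct) (auto simp: sorted_map)

lemma length_eq_endpoint: "length p = count_list p East + count_list p North"
  by (induction p rule: east_heights.induct) auto

lemma east_heights_inject:
  assumes "east_heights p = east_heights q" "count_list p North = count_list q North"
  shows "p = q"
  using assms
proof (induction p arbitrary: q rule: east_heights.induct)
  case 1
  then show ?case by (cases q rule: east_heights.cases) auto
next
  case (2 p)
  then show ?case by (cases q rule: east_heights.cases) auto
next
  case (3 p)
  then show ?case by (cases q rule: east_heights.cases) (auto simp: inj_map_eq_map)
qed

lemma east_heights_exists:
  assumes "sorted l" "\<And>h. h \<in> set l \<Longrightarrow> h \<le> N"
  shows "\<exists>p. east_heights p = l \<and> count_list p North = N"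
  using assms
proof (induction l arbitrary: N rule: rev_induct)
  case Nil
  show ?case by (rule exI[of _ "replicate N North"]) (simp add: count_list_replicate)
next
  case (snoc h l)
  from snoc.prems have "sorted l" "\<And>h'. h' \<in> set l \<Longrightarrow> h' \<le> h"
    by (auto simp: sorted_append)
  then obtain p where "east_heights p = l" "count_list p North = h"
    using snoc.IH by blast
  moreover have "h \<le> N" using snoc.prems by simp
  ultimately show ?case
    by (intro exI[of _ "p @ East # replicate (N - h) North"])
       (simp add: east_heights_append count_list_replicate)
qed

lemma horizontal_steps_snoc:
  "horizontal_steps (p @ [s]) = horizontal_steps p \<union> (if s = East then {endpoint p} else {})"
  unfolding horizontal_steps_def by auto

lemma points_snoc: "points (p @ [s]) = insert (endpoint (p @ [s])) (points p)"
  unfolding points_def by auto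

lemma horizontal_steps_eq:
  "horizontal_steps p = {(i, y). i < count_list p East \<and> y = east_heights p ! i}"
proof (induction p rule: rev_induct)
  case Nil
  show ?case by (simp add: horizontal_steps_def)
next
  case (snoc s p)
  have "{(i, y). i < Suc (count_list p East) \<and>
           y = (east_heights p @ [count_list p North]) ! i} =
        insert (endpoint p) {(i, y). i < count_list p East \<and> y = east_heights p ! i}"
    by (auto simp: nth_append length_east_heights endpoint_def less_Suc_eq)
  then show ?case
    by (cases s) (simp_all add: horizontal_steps_snoc snoc east_heights_append)
qed

text \<open>At abscissa \<open>x\<close> a path occupies the vertical segment between the East steps
  on either side of \<open>x\<close>. Heights increase weakly, so bounding \<open>y\<close> by all
  earlier and all later steps says the same, uniformly up to both ends of the path.\<close>

lemma points_eq:
  "points p = {(x, y). x \<le> count_list p East \<and> y \<le> count_list p North \<and>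
     (\<forall>i<x. east_heights p ! i \<le> y) \<and>
     (\<forall>i. x \<le> i \<longrightarrow> i < count_list p East \<longrightarrow> y \<le> east_heights p ! i)}"
proof (induction p rule: rev_induct)
  case Nil
  show ?case by (auto simp: points_def endpoint_def)
next
  case (snoc s p)
  have le: "east_heights p ! i \<le> count_list p North" if "i < count_list p East" for i
    using east_heights_le[of "east_heights p ! i" p] that by (simp add: length_east_heights)
  show ?case
  proof (cases s)
    case North
    have "(x, y) \<in> points (p @ [s]) \<longleftrightarrow> x \<le> count_list p East \<and> y \<le> Suc (count_list p North) \<and>
       (\<forall>i<x. east_heights p ! i \<le> y) \<and>
       (\<forall>i. x \<le> i \<longrightarrow> i < count_list p East \<longrightarrow> y \<le> east_heights p ! i)" for x y
    proof (cases "y = Suc (count_list p North)")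
      case True
      have "x = count_list p East"
        if "x \<le> count_list p East" "\<And>i. x \<le> i \<Longrightarrow> i < count_list p East \<Longrightarrow> y \<le> east_heights p ! i"
        using that le[of x] True by fastforce
      with True show ?thesis
        using le by (auto simp: points_snoc snoc North endpoint_def le_SucI)
    next
      case False
      then show ?thesis by (auto simp: points_snoc snoc North endpoint_def)
    qed
    then show ?thesis using North by (auto simp: east_heights_append)
  next
    case East
    have "(x, y) \<in> points (p @ [s]) \<longleftrightarrow> x \<le> Suc (count_list p East) \<and> y \<le> count_list p North \<and>
       (\<forall>i<x. (east_heights p @ [count_list p North]) ! i \<le> y) \<and>
       (\<forall>i. x \<le> i \<longrightarrow> i < Suc (count_list p East) \<longrightarrow>
          y \<le> (east_heights p @ [count_list p North]) ! i)" for x y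
    proof (cases "x = Suc (count_list p East)")
      case True
      then show ?thesis
        using le by (auto simp: points_snoc snoc East endpoint_def nth_append length_east_heights
            less_Suc_eq all_conj_distrib)
    next
      case False
      then show ?thesis
        by (auto simp: points_snoc snoc East endpoint_def nth_append length_east_heights less_Suc_eq)
    qed
    then show ?thesis using East by (auto simp: east_heights_append)
  qed
qed

text \<open>Heights increase weakly, so the East steps at the final height are exactly the final
  run. Reading a path backwards thus becomes a count of columns.\<close>

lemma trailing_East_eq:
  "length (takeWhile (\<lambda>s. s = East) (rev q)) =
     card {i. i < count_list q East \<and> east_heights q ! i = count_list q North}"
proof (induction q rule: rev_induct)
  case Nil
  show ?case by simp
next
  case (snoc s q)
  show ?case
  proof (cases s)
    case North
    have "east_heights q ! i \<noteq> Suc (count_list q North)" if "i < count_list q East" for i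
      using east_heights_le[of "east_heights q ! i" q] that by (auto simp: length_east_heights)
    then have "{i. i < count_list q East \<and> east_heights q ! i = Suc (count_list q North)} = {}"
      by auto
    then show ?thesis using North by (simp add: east_heights_append)
  next
    case East
    have "{i. i < Suc (count_list q East) \<and>
             (east_heights q @ [count_list q North]) ! i = count_list q North} =
       insert (count_list q East)
         {i. i < count_list q East \<and> east_heights q ! i = count_list q North}"
      by (auto simp: nth_append length_east_heights less_Suc_eq)
    then show ?thesis using East snoc by (simp add: east_heights_append)
  qed
qed

text \<open>The lists \<open>l\<close> and \<open>u\<close> hold the lower and upper ends of the columns; the last condition makes
  neighbouring columns share an edge.\<close>

definition stair :: "nat list \<Rightarrow> nat list \<Rightarrow> bool" where
  "stair l u \<longleftrightarrow> l \<noteq> [] \<and> length u = length l \<and> sorted l \<and> sorted u \<and> l ! 0 = 0 \<and>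
     (\<forall>i<length l. l ! i < u ! i) \<and> (\<forall>i. Suc i < length l \<longrightarrow> l ! Suc i < u ! i)"

definition region :: "nat list \<Rightarrow> nat list \<Rightarrow> cell set" where
  "region l u = {(i, j). i < length l \<and> l ! i \<le> j \<and> j < u ! i}"

text \<open>At an interior abscissa the paths avoid each other only if one passes strictly below the
  other there. A non-empty column decides which one is lower, and this order spreads to all columns.
  The condition on \<open>last\<close> says that the upper path ends with an East step.\<close>

lemma bounded_by_iff:
  "bounded_by L U P \<longleftrightarrow> count_list L North = count_list U North \<and>
     count_list U North = last (east_heights U) \<and>
     stair (east_heights L) (east_heights U) \<and> P = region (east_heights L) (east_heights U)"
  (is "?lhs \<longleftrightarrow> ?rhs")
proof -
  define l where "l = east_heights L"
  define u where "u = east_heights U"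
  define M where "M = length l"
  define N where "N = count_list L North"
  have l_le: "l ! i \<le> N" if "i < M" for i
    using east_heights_le[of "l ! i" L] that unfolding l_def M_def N_def by simp
  have sl: "l ! i \<le> l ! j" if "i \<le> j" "j < M" for i j
    using sorted_east_heights[of L] that unfolding l_def M_def by (simp add: sorted_nth_mono)
  have cL: "count_list L East = M"
    by (simp add: M_def l_def length_east_heights)
  show ?thesis
  \<comment> \<open>Each side forces equal numbers of East and of North steps, so the mismatched
    case is vacuous.\<close>
  proof (cases "length u = M \<and> count_list U North = N")
    case False
    have "length u = M \<and> count_list U North = N" if ?lhs
    proof -
      have "endpoint L = endpoint U" using that by (simp add: bounded_by_def)
      then show ?thesis
        using cL by (simp add: endpoint_def u_def N_def length_east_heights)
    qed
    moreover have "length u = M \<and> count_list U North = N" if ?rhs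
      using that by (simp add: stair_def u_def N_def M_def l_def)
    ultimately show ?thesis using False by blast
  next
    case True
    then have lu: "length u = M" and NU: "count_list U North = N" by auto
    have cU: "count_list U East = M"
      using lu by (simp add: u_def length_east_heights)
    have u_le: "u ! i \<le> N" if "i < M" for i
      using east_heights_le[of "u ! i" U] that lu NU unfolding u_def by simp
    have su: "u ! i \<le> u ! j" if "i \<le> j" "j < M" for i j
      using sorted_east_heights[of U] that lu unfolding u_def by (simp add: sorted_nth_mono)
    have pL: "points L = {(x, y). x \<le> M \<and> y \<le> N \<and> (\<forall>i<x. l ! i \<le> y) \<and>
       (\<forall>i. x \<le> i \<longrightarrow> i < M \<longrightarrow> y \<le> l ! i)}"
      unfolding points_eq cL l_def[symmetric] N_def[symmetric] ..
    have pU: "points U = {(x, y). x \<le> M \<and> y \<le> N \<and> (\<forall>i<x. u ! i \<le> y) \<and>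
       (\<forall>i. x \<le> i \<longrightarrow> i < M \<longrightarrow> y \<le> u ! i)}"
      unfolding points_eq cU u_def[symmetric] NU ..
    have cells: "cells_between L U = region l u"
      unfolding cells_between_def region_def horizontal_steps_eq cL cU
      by (auto simp: M_def l_def u_def)
    show ?thesis
    proof
      assume ?lhs
      then have int: "points L \<inter> points U = {(0, 0), (M, N)}" and P: "P = region l u"
        and ne: "region l u \<noteq> {}"
        using cells by (auto simp: bounded_by_def endpoint_def cL N_def)
      have M0: "0 < M" using ne by (auto simp: region_def M_def)
      have sep: "l ! x < u ! (x - 1) \<or> u ! x < l ! (x - 1)" if x: "0 < x" "x < M" for x
      proof (rule ccontr)
        assume "\<not> ?thesis"
        then have *: "u ! (x - 1) \<le> l ! x" "l ! (x - 1) \<le> u ! x" by auto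
        \<comment> \<open>If the two vertical segments at \<open>x\<close> overlap, the higher of
          their lower ends lies on both.\<close>
        define y where "y = max (l ! (x - 1)) (u ! (x - 1))"
        have "(x, y) \<in> points L"
        proof -
          have "y \<le> l ! x" using * sl[of "x - 1" x] x by (auto simp: y_def)
          moreover have "l ! i \<le> y" if "i < x" for i
            using sl[of i "x - 1"] x that by (simp add: y_def le_max_iff_disj)
          moreover have "y \<le> l ! i" if "x \<le> i" "i < M" for i
            using sl[OF that] \<open>y \<le> l ! x\<close> by simp
          moreover have "y \<le> N" using l_le[of x] \<open>y \<le> l ! x\<close> x by simp
          ultimately show ?thesis
            using x by (simp add: pL)
        qed
        moreover have "(x, y) \<in> points U"
        proof -
          have "y \<le> u ! x" using * su[of "x - 1" x] x by (auto simp: y_def)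
          moreover have "u ! i \<le> y" if "i < x" for i
            using su[of i "x - 1"] x that by (simp add: y_def le_max_iff_disj)
          moreover have "y \<le> u ! i" if "x \<le> i" "i < M" for i
            using su[OF that] \<open>y \<le> u ! x\<close> by simp
          moreover have "y \<le> N" using u_le[of x] \<open>y \<le> u ! x\<close> x by simp
          ultimately show ?thesis
            using x by (simp add: pU)
        qed
        ultimately have "(x, y) \<in> points L \<inter> points U" by (rule IntI)
        then show False unfolding int using x by simp
      qed
      \<comment> \<open>In a column containing a cell the lower path is below the upper one;
        \<open>up\<close> and \<open>down\<close> carry this order to the right and to the left,
        where \<open>sep\<close> excludes a swap.\<close>
      obtain i0 where i0: "i0 < M" "l ! i0 < u ! i0"
        using ne by (force simp: region_def M_def)
      have up: "l ! i < u ! i \<and> (i0 < i \<longrightarrow> l ! i < u ! (i - 1))" if "i0 \<le> i" "i < M" for i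
        using that
      proof (induction i rule: dec_induct)
        case base
        then show ?case using i0 by simp
      next
        case (step i)
        then have "l ! i < u ! i" by simp
        then show ?case
          using sep[of "Suc i"] su[of i "Suc i"] step.prems by auto
      qed
      have down: "l ! i < u ! i \<and> (i < i0 \<longrightarrow> l ! Suc i < u ! i)" if "i \<le> i0" for i
        using that
      proof (induction i rule: inc_induct)
        case base
        then show ?case using i0 by simp
      next
        case (step i)
        then have "l ! Suc i < u ! Suc i" by simp
        then show ?case
          using sep[of "Suc i"] sl[of i "Suc i"] i0 step.hyps by auto
      qed
      have lt: "l ! i < u ! i" if "i < M" for i
        using up[of i] down[of i] that by (cases "i \<le> i0") auto
      have lt2: "l ! Suc i < u ! i" if "Suc i < M" for i
        using up[of "Suc i"] down[of i] that by (cases "i < i0") auto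
      \<comment> \<open>The point (0, \<open>l ! 0\<close>) lies on both paths, so it is the origin;
        likewise (\<open>M\<close>, \<open>u ! (M - 1)\<close>) is the common endpoint.\<close>
      have "l ! 0 \<le> l ! i" if "i < M" for i
        using sl[of 0 i] that by simp
      moreover have "l ! 0 \<le> u ! i" if "i < M" for i
        using sl[of 0 i] lt[of i] that by simp
      ultimately have "(0, l ! 0) \<in> points L \<inter> points U"
        using M0 l_le[of 0] by (simp add: pL pU)
      then have l0: "l ! 0 = 0" unfolding int using M0 by simp
      have u_last: "u ! i \<le> u ! (M - 1)" if "i < M" for i
        using su[of i "M - 1"] that by simp
      moreover have "l ! i \<le> u ! (M - 1)" if "i < M" for i
        using u_last[OF that] lt[OF that] by simp
      ultimately have "(M, u ! (M - 1)) \<in> points L \<inter> points U"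
        using M0 u_le[of "M - 1"] by (simp add: pL pU)
      then have uM: "u ! (M - 1) = N" unfolding int using M0 by simp
      have "u \<noteq> []" using lu M0 by auto
      then have "last u = N" using uM lu by (simp add: last_conv_nth)
      moreover have "stair l u"
        unfolding stair_def
        using l0 lt lt2 M0 lu sorted_east_heights[of L] sorted_east_heights[of U]
        by (simp add: M_def l_def[symmetric] u_def[symmetric])
      ultimately show ?rhs
        using P NU by (simp add: l_def u_def N_def)
    next
      assume ?rhs
      then have st: "stair l u" and P: "P = region l u" and uN: "last u = N"
        by (auto simp: l_def u_def N_def)
      have M0: "0 < M" using st by (simp add: stair_def M_def)
      have l0: "l ! 0 = 0" using st by (simp add: stair_def)
      have lt: "l ! i < u ! i" if "i < M" for i using st that by (simp add: stair_def M_def)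
      have lt2: "l ! Suc i < u ! i" if "Suc i < M" for i using st that by (simp add: stair_def M_def)
      have uM: "u ! (M - 1) = N" using uN lu M0 by (metis last_conv_nth length_greater_0_conv)
      \<comment> \<open>A common point at an interior abscissa would be at most
        \<open>l ! Suc x'\<close> and at least \<open>u ! x'\<close>, against the last condition of
        \<open>stair\<close>.\<close>
      have "x = 0 \<and> y = 0 \<or> x = M \<and> y = N"
        if xy: "(x, y) \<in> points L" "(x, y) \<in> points U" for x y
      proof (cases "x < M")
        case True
        have "x = 0"
        proof (rule ccontr)
          assume "x \<noteq> 0"
          then obtain x' where "x = Suc x'" by (cases x) auto
          then have "y \<le> l ! Suc x'" "u ! x' \<le> y" using xy True by (auto simp: pL pU)
          then show False using lt2[of x'] True \<open>x = Suc x'\<close> by auto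
        qed
        moreover have "y = 0" using xy(1) \<open>x = 0\<close> l0 M0 by (auto simp: pL)
        ultimately show ?thesis by simp
      next
        case False
        then have "x = M" "y \<le> N" using xy(1) by (auto simp: pL)
        moreover have "N \<le> y" using xy(2) uM M0 \<open>x = M\<close> by (auto simp: pU)
        ultimately show ?thesis by simp
      qed
      then have "points L \<inter> points U \<subseteq> {(0, 0), (M, N)}" by auto
      moreover have "{(0, 0), (M, N)} \<subseteq> points L \<inter> points U"
        using l_le u_le by (auto simp: pL pU)
      moreover have "(0, 0) \<in> region l u"
        using l0 lt[of 0] M0 by (auto simp: region_def M_def)
      ultimately show ?lhs
        using P cells NU cU cL by (auto simp: bounded_by_def endpoint_def N_def)
    qed
  qed
qed

section \<open>Regions: connectedness and recovery of the borders\<close>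

lemma mem_region_iff: "(i, j) \<in> region l u \<longleftrightarrow> i < length l \<and> l ! i \<le> j \<and> j < u ! i"
  by (simp add: region_def)

lemma stairD:
  assumes "stair l u"
  shows "l \<noteq> []" "u \<noteq> []" "length u = length l" "0 < length l" "l ! 0 = 0"
    "\<And>i. i < length l \<Longrightarrow> l ! i < u ! i"
    "\<And>i. Suc i < length l \<Longrightarrow> l ! Suc i < u ! i"
    "\<And>i j. i \<le> j \<Longrightarrow> j < length l \<Longrightarrow> l ! i \<le> l ! j"
    "\<And>i j. i \<le> j \<Longrightarrow> j < length l \<Longrightarrow> u ! i \<le> u ! j"
    "last l = l ! (length l - 1)" "last u = u ! (length l - 1)"
    "\<And>i. i < length l \<Longrightarrow> u ! i \<le> last u" "last l < last u"
proof -
  show *: "l \<noteq> []" "length u = length l" "l ! 0 = 0"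
    "\<And>i. i < length l \<Longrightarrow> l ! i < u ! i"
    "\<And>i. Suc i < length l \<Longrightarrow> l ! Suc i < u ! i"
    using assms by (auto simp: stair_def)
  show ne: "u \<noteq> []" using * by auto
  show M: "0 < length l" using * by auto
  show "\<And>i j. i \<le> j \<Longrightarrow> j < length l \<Longrightarrow> l ! i \<le> l ! j"
    using assms by (simp add: stair_def sorted_nth_mono)
  show su: "\<And>i j. i \<le> j \<Longrightarrow> j < length l \<Longrightarrow> u ! i \<le> u ! j"
    using assms by (simp add: stair_def sorted_nth_mono)
  show ll: "last l = l ! (length l - 1)" using * by (simp add: last_conv_nth)
  show lu: "last u = u ! (length l - 1)" using * ne by (simp add: last_conv_nth)
  show "\<And>i. i < length l \<Longrightarrow> u ! i \<le> last u" using su lu by simp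
  show "last l < last u" using ll lu *(4)[of "length l - 1"] M by simp
qed

text \<open>Every cell is joined to the corner cell by moving down inside its column and, from the
  bottom of the column, to the left; neighbouring columns overlap, so the left move stays
  inside.\<close>

lemma edge_connected_region:
  assumes "stair l u"
  shows "edge_connected (region l u)"
proof -
  let ?R = "{(a, b). a \<in> region l u \<and> b \<in> region l u \<and> adjacent a b}"
  note st = stairD[OF assms]
  have "((i, j), (0, 0)) \<in> ?R\<^sup>*" if "(i, j) \<in> region l u" for i j
    using that
  proof (induction "i + j" arbitrary: i j rule: less_induct)
    case less
    note ij = less.prems[unfolded mem_region_iff]
    have step: ?case if "(i', j') \<in> region l u" "adjacent (i, j) (i', j')" "i' + j' < i + j" for i' j'
      using less.hyps[OF that(3,1)] that less.prems by (blast intro: converse_rtrancl_into_rtrancl)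
    consider "l ! i < j" | "l ! i = j" "i = 0" | i' where "l ! i = j" "i = Suc i'"
      using ij by (cases i) (auto simp: le_less)
    then show ?case
    proof cases
      case 1
      then show ?thesis
        using ij by (intro step[of i "j - 1"]) (auto simp: mem_region_iff adjacent_def)
    next
      case 2
      then show ?thesis using st(5) by simp
    next
      case 3
      then show ?thesis
        using ij st(7)[of i'] st(8)[of i' i]
        by (intro step[of i' j]) (auto simp: mem_region_iff adjacent_def)
    qed
  qed
  moreover have "sym (?R\<^sup>*)"
    by (intro sym_rtrancl symI) (auto simp: adjacent_def)
  ultimately show ?thesis
    unfolding edge_connected_def by (metis (no_types, lifting) rtrancl_trans surj_pair symD)
qed

lemma bounded_by_region_exists:
  assumes "stair l u"
  obtains L U where "bounded_by L U (region l u)" "east_heights L = l" "count_list L North = last u"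
proof -
  note st = stairD[OF assms]
  have "h \<le> last u" if "h \<in> set l" for h
    using that st(6) st(12) by (fastforce simp: in_set_conv_nth)
  then obtain L where "east_heights L = l" "count_list L North = last u"
    using east_heights_exists[of l "last u"] assms by (auto simp: stair_def)
  moreover have "h \<le> last u" if "h \<in> set u" for h
    using that st(3) st(12) by (auto simp: in_set_conv_nth)
  then obtain U where "east_heights U = u" "count_list U North = last u"
    using east_heights_exists[of u "last u"] assms by (auto simp: stair_def)
  ultimately show ?thesis
    using assms by (intro that[of L U]) (simp_all add: bounded_by_iff)
qed

text \<open>Bounding paths force the staircase conditions, and these in turn give
  edge-connectedness.\<close>

lemma parallelogram_polyomino_iff:
  "parallelogram_polyomino P \<longleftrightarrow> (\<exists>l u. stair l u \<and> P = region l u)"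
  unfolding parallelogram_polyomino_def
  by (metis bounded_by_iff bounded_by_region_exists edge_connected_region)

lemma column_region:
  "i < length l \<Longrightarrow> {j. (i, j) \<in> region l u} = {l ! i..<u ! i}"
  by (auto simp: mem_region_iff)

lemma fst_region:
  assumes "stair l u"
  shows "fst ` region l u = {..<length l}"
  using stairD(6)[OF assms] by (force simp: region_def)

lemma finite_region: "finite (region l u)"
proof -
  have "region l u = Sigma {..<length l} (\<lambda>i. {l ! i..<u ! i})"
    by (auto simp: region_def)
  then show ?thesis by simp
qed

text \<open>All columns are non-empty intervals, so their ends can be read off the set of
  cells.\<close>

lemma region_inject:
  assumes "stair l u" "stair l' u'" "region l u = region l' u'"
  shows "l = l' \<and> u = u'"
proof -
  note st = stairD[OF assms(1)] and st' = stairD[OF assms(2)]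
  have len: "length l = length l'"
    using fst_region[OF assms(1)] fst_region[OF assms(2)] assms(3)
    by (metis card_lessThan)
  have "l ! i = l' ! i \<and> u ! i = u' ! i" if "i < length l" for i
    using column_region[of i l u] column_region[of i l' u'] assms(3) that len st(6) st'(6)
    by (simp add: atLeastLessThan_eq_iff)
  then show ?thesis
    using len st(3) st'(3) by (auto intro: nth_equalityI)
qed

text \<open>Uniqueness of the staircase makes the definite description in
  \<open>lower_border\<close> denote the path with heights \<open>l\<close>; it shares its final
  height \<open>last u\<close> with the upper path.\<close>

lemma lower_border_region:
  assumes "stair l u"
  shows "east_heights (lower_border (region l u)) = l"
    "count_list (lower_border (region l u)) North = last u"
proof -
  obtain L where L: "\<exists>U. bounded_by L U (region l u)" "east_heights L = l" "count_list L North = last u"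
    using bounded_by_region_exists[OF assms] by metis
  have "L' = L" if "\<exists>U. bounded_by L' U (region l u)" for L'
  proof -
    from that obtain U where "bounded_by L' U (region l u)" by blast
    then have *: "stair (east_heights L') (east_heights U)" "count_list L' North = last (east_heights U)"
      "region (east_heights L') (east_heights U) = region l u"
      by (auto simp: bounded_by_iff)
    then show ?thesis
      using region_inject[OF *(1) assms *(3)] L east_heights_inject[of L' L] by simp
  qed
  then have "lower_border (region l u) = L"
    unfolding lower_border_def using L(1) by (rule the_equality[rotated])
  then show "east_heights (lower_border (region l u)) = l"
    "count_list (lower_border (region l u)) North = last u"
    using L by auto
qed

section \<open>Horizontal runs, top rows and right columns\<close>

definition run_length :: "nat list \<Rightarrow> nat \<Rightarrow> nat" where
  "run_length l x = card {i. i < x \<and> l ! i = l ! (x - 1)}"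

text \<open>The lowest point of the lower border at abscissa \<open>x\<close> is the right end of
  the East step under column \<open>x - 1\<close>. The trailing East steps of the path up to that
  point are the columns left of \<open>x\<close> with the same bottom.\<close>

lemma r_value_region:
  assumes "stair l u" "x = Suc (Max (fst ` b))" "x \<le> length l"
  shows "r_value (region l u) b = run_length l x"
proof -
  note st = stairD[OF assms(1)]
  define L where "L = lower_border (region l u)"
  have L: "east_heights L = l" "count_list L North = last u" "count_list L East = length l"
    using lower_border_region[OF assms(1)] length_east_heights[of L] by (simp_all add: L_def)
  have x0: "0 < x" using assms(2) by simp
  have "l ! (x - 1) < u ! (x - 1)" "u ! (x - 1) \<le> last u"
    using st(6)[of "x - 1"] st(12)[of "x - 1"] x0 assms(3) by auto
  then have *: "(x, l ! (x - 1)) \<in> points L"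
    using x0 assms(3) st(8) by (auto simp: points_eq L)
  moreover have "finite {y. (x, y) \<in> points L}"
    by (rule finite_subset[of _ "{..last u}"]) (auto simp: points_eq L)
  moreover have "l ! (x - 1) \<le> y" if "(x, y) \<in> points L" for y
    using that x0 by (auto simp: points_eq L)
  ultimately have "Min {y. (x, y) \<in> points L} = l ! (x - 1)"
    by (intro Min_eqI) auto
  then have foot: "foot (region l u) b = (x, l ! (x - 1))"
    unfolding foot_def Let_def L_def[symmetric] assms(2)[symmetric] by simp
  obtain q where q: "prefix q L" "endpoint q = (x, l ! (x - 1))"
    using * by (auto simp: points_def)
  \<comment> \<open>The coordinates of its endpoint fix the length of a prefix, hence the
    prefix.\<close>
  have "q' = q" if "prefix q' L" "endpoint q' = (x, l ! (x - 1))" for q'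
  proof -
    have "length q' = length q"
      using that q by (simp add: endpoint_def length_eq_endpoint)
    then show ?thesis
      using q(1) that(1) by (metis append_eq_append_conv prefix_def)
  qed
  then have "(THE q. prefix q L \<and> endpoint q = (x, l ! (x - 1))) = q"
    using q by blast
  then have "r_value (region l u) b = length (takeWhile (\<lambda>s. s = East) (rev q))"
    unfolding r_value_def foot L_def[symmetric] by simp
  also have "\<dots> = card {i. i < x \<and> east_heights q ! i = l ! (x - 1)}"
    using q(2) by (simp add: trailing_East_eq endpoint_def)
  also have "{i. i < x \<and> east_heights q ! i = l ! (x - 1)} = {i. i < x \<and> l ! i = l ! (x - 1)}"
  proof -
    obtain q' where "L = q @ q'" using q(1) by (auto simp: prefix_def)
    then have "l = east_heights q @ map (\<lambda>h. h + count_list q North) (east_heights q')"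
      using L(1) by (simp add: east_heights_append)
    moreover have "length (east_heights q) = x"
      using q(2) by (simp add: length_east_heights endpoint_def)
    ultimately have "l ! i = east_heights q ! i" if "i < x" for i
      using that by (simp add: nth_append)
    then show ?thesis by auto
  qed
  finally show ?thesis by (simp add: run_length_def)
qed

lemma Max_fst_region:
  assumes "stair l u"
  shows "Max (fst ` region l u) = length l - 1" "Min (fst ` region l u) = 0"
  unfolding fst_region[OF assms] using stairD(4)[OF assms] by (auto intro!: Max_eqI Min_eqI)

lemma Max_snd_region:
  assumes "stair l u"
  shows "Max (snd ` region l u) = last u - 1" "Min (snd ` region l u) = 0"
proof -
  note st = stairD[OF assms]
  have "(length l - 1, last u - 1) \<in> region l u" "(0, 0) \<in> region l u"
    using st(4,5,10,11,13) st(6)[of 0] by (auto simp: mem_region_iff)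
  then have "last u - 1 \<in> snd ` region l u" "0 \<in> snd ` region l u" by force+
  moreover have "j \<le> last u - 1" if "j \<in> snd ` region l u" for j
    using that st(12) by (fastforce simp: region_def)
  ultimately show "Max (snd ` region l u) = last u - 1" "Min (snd ` region l u) = 0"
    by (auto intro: Max_eqI Min_eqI finite_imageI finite_region)
qed

lemma psize_region:
  assumes "stair l u"
  shows "psize (region l u) = length l + last u - 1"
  unfolding psize_def width_def height_def Max_fst_region[OF assms] Max_snd_region[OF assms]
  using stairD(4,13)[OF assms] by simp

lemma top_row_region:
  assumes "stair l u"
  shows "top_row (region l u) = {(i, j). i < length l \<and> u ! i = last u \<and> Suc j = last u}"
  unfolding top_row_def Max_snd_region[OF assms]
  using stairD(6,12)[OF assms] stairD(13)[OF assms] by (fastforce simp: region_def)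

lemma right_column_region:
  assumes "stair l u"
  shows "right_column (region l u) = {(i, j). Suc i = length l \<and> last l \<le> j \<and> j < last u}"
  unfolding right_column_def Max_fst_region[OF assms]
  using stairD(4,10,11)[OF assms] by (cases "length l") (auto simp: region_def)

section \<open>Adding a row or a column\<close>

text \<open>For a sorted \<open>u\<close> this is the width of the top row, hence the largest width
  of a row that can be put on top flush with the right edge.\<close>

definition top_width :: "nat list \<Rightarrow> nat" where
  "top_width u = card {i. i < length u \<and> u ! i = last u}"

text \<open>The new row sits flush right. If \<open>u\<close> is sorted and \<open>w\<close> is at
  most \<open>top_width u\<close>, each of the last \<open>w\<close> columns grows by a single
  cell.\<close>

definition raise :: "nat \<Rightarrow> nat list \<Rightarrow> nat list" where
  "raise w u = take (length u - w) u @ replicate w (Suc (last u))"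

lemma length_raise: "w \<le> length u \<Longrightarrow> length (raise w u) = length u"
  by (simp add: raise_def)

lemma nth_raise:
  "w \<le> length u \<Longrightarrow> i < length u \<Longrightarrow>
     raise w u ! i = (if i < length u - w then u ! i else Suc (last u))"
  by (auto simp: raise_def nth_append)

lemma last_raise: "0 < w \<Longrightarrow> last (raise w u) = Suc (last u)"
  by (simp add: raise_def)

text \<open>In a sorted list the columns of full height form a final segment, so comparing
  \<open>w\<close> with their number amounts to a condition on the last \<open>w\<close>
  entries.\<close>

lemma top_width_iff:
  assumes "sorted u" "u \<noteq> []"
  shows "w \<le> top_width u \<longleftrightarrow> w \<le> length u \<and> (\<forall>i<length u. length u - w \<le> i \<longrightarrow> u ! i = last u)"
proof -
  let ?n = "length u"
  let ?A = "{i. i < ?n \<and> u ! i = last u}"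
  have last: "last u = u ! (?n - 1)" using assms by (simp add: last_conv_nth)
  have up: "j \<in> ?A" if "i \<in> ?A" "i \<le> j" "j < ?n" for i j
    using that last sorted_nth_mono[OF assms(1), of i j] sorted_nth_mono[OF assms(1), of j "?n - 1"]
    by auto
  show ?thesis
  proof
    assume w: "w \<le> top_width u"
    have "top_width u \<le> card {..<?n}"
      unfolding top_width_def by (rule card_mono) auto
    then have "w \<le> ?n" using w by simp
    moreover have "u ! i = last u" if i: "i < ?n" "?n - w \<le> i" for i
    proof (rule ccontr)
      assume "u ! i \<noteq> last u"
      then have "?A \<subseteq> {i<..<?n}"
        using up[of _ i] i by (auto simp: not_le[symmetric])
      then have "top_width u \<le> card {i<..<?n}"
        unfolding top_width_def by (rule card_mono[rotated]) simp
      then show False using w i by simp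
    qed
    ultimately show "w \<le> ?n \<and> (\<forall>i<?n. ?n - w \<le> i \<longrightarrow> u ! i = last u)" by blast
  next
    assume w: "w \<le> ?n \<and> (\<forall>i<?n. ?n - w \<le> i \<longrightarrow> u ! i = last u)"
    then have "{?n - w..<?n} \<subseteq> ?A" by auto
    then have "card {?n - w..<?n} \<le> top_width u"
      unfolding top_width_def by (rule card_mono[rotated]) simp
    then show "w \<le> top_width u" using w by simp
  qed
qed

text \<open>The top right cell shows that top row and right column are non-empty and overlap; the
  overlap later separates a last row from a last column.\<close>

lemma corner_in_top_row_right_column:
  assumes "stair l u"
  shows "(length l - 1, last u - 1) \<in> top_row (region l u) \<inter> right_column (region l u)"
  using stairD(4,11,13)[OF assms] by (simp add: top_row_region right_column_region assms)

text \<open>The last \<open>w\<close> columns all have full height, so raising them adds exactly one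
  cell to each, and these cells form the new top row.\<close>

lemma
  assumes st: "stair l u" and w: "1 \<le> w" "w \<le> top_width u"
  shows stair_raise: "stair l (raise w u)"
    and top_row_raise:
      "top_row (region l (raise w u)) = (\<lambda>i. (i, last u)) ` {length l - w..<length l}"
    and region_raise_minus: "region l (raise w u) - top_row (region l (raise w u)) = region l u"
proof -
  note std = stairD[OF st]
  have su: "sorted u" using st by (simp add: stair_def)
  have top: "u ! i = last u" if "i < length l" "length l - w \<le> i" for i
    using w(2) std(3) that unfolding top_width_iff[OF su std(2)] by auto
  have wl: "w \<le> length u" using w(2) unfolding top_width_iff[OF su std(2)] by simp
  note nth = nth_raise[OF wl]
  have "raise w u ! i \<le> raise w u ! j" if "i \<le> j" "j < length l" for i j
    using that std(3) std(9)[of i j] std(12)[of i] by (auto simp: nth)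
  then have "sorted (raise w u)"
    using length_raise[OF wl] std(3) by (simp add: sorted_iff_nth_mono)
  moreover have ge: "u ! i \<le> raise w u ! i" if "i < length l" for i
    using that std(3) std(12)[of i] by (auto simp: nth)
  moreover have "l ! i < raise w u ! i" if "i < length l" for i
    using std(6)[OF that] ge[OF that] by simp
  moreover have "l ! Suc i < raise w u ! i" if "Suc i < length l" for i
    using std(7)[OF that] ge[of i] that by simp
  ultimately show st': "stair l (raise w u)"
    using st length_raise[OF wl] by (auto simp: stair_def)
  have iff: "raise w u ! i = Suc (last u) \<longleftrightarrow> length l - w \<le> i" if "i < length l" for i
    using that std(3) std(12)[of i] by (auto simp: nth)
  show tr: "top_row (region l (raise w u)) = (\<lambda>i. (i, last u)) ` {length l - w..<length l}"
    unfolding top_row_region[OF st'] using w iff by (auto simp: last_raise)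
  have "i < length l \<and> l ! i \<le> j \<and> j < raise w u ! i \<and> \<not> (length l - w \<le> i \<and> j = last u) \<longleftrightarrow>
      i < length l \<and> l ! i \<le> j \<and> j < u ! i" for i j
  proof (cases "i < length l \<and> length l - w \<le> i")
    case True
    then show ?thesis using top[of i] iff[of i] by auto
  next
    case False
    then show ?thesis using std(3) by (auto simp: nth)
  qed
  then have "{(i, j). i < length l \<and> l ! i \<le> j \<and> j < raise w u ! i \<and>
      \<not> (length l - w \<le> i \<and> j = last u)} = region l u"
    unfolding region_def by presburger
  moreover have "region l (raise w u) - (\<lambda>i. (i, last u)) ` {length l - w..<length l} =
      {(i, j). i < length l \<and> l ! i \<le> j \<and> j < raise w u ! i \<and>
        \<not> (length l - w \<le> i \<and> j = last u)}"
    by (auto simp: region_def)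
  ultimately show "region l (raise w u) - top_row (region l (raise w u)) = region l u"
    unfolding tr by simp
qed

text \<open>The new column runs from \<open>c\<close> to the common top. The bound
  \<open>last l \<le> c\<close> keeps the bottoms sorted, and \<open>c < last u\<close> makes the
  column non-empty and gives it an edge in common with the previous one.\<close>

lemma
  assumes st: "stair l u" and c: "last l \<le> c" "c < last u"
  shows stair_snoc: "stair (l @ [c]) (u @ [last u])"
    and region_snoc_minus:
      "region (l @ [c]) (u @ [last u]) - right_column (region (l @ [c]) (u @ [last u])) = region l u"
proof -
  note std = stairD[OF st]
  have "x \<le> c" if "x \<in> set l" for x
  proof -
    obtain i where "i < length l" "x = l ! i" using \<open>x \<in> set l\<close> by (auto simp: in_set_conv_nth)
    then have "x \<le> l ! (length l - 1)" using std(8)[of i "length l - 1"] by simp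
    then show ?thesis using std(10) c(1) by simp
  qed
  moreover have "x \<le> last u" if "x \<in> set u" for x
    using that std(12) std(3) by (auto simp: in_set_conv_nth)
  moreover have "c < u ! i" if "Suc i = length l" for i
  proof -
    have "i = length l - 1" using that by simp
    then show ?thesis using c(2) std(11) by simp
  qed
  ultimately show st': "stair (l @ [c]) (u @ [last u])"
    using st std(4) c unfolding stair_def
    by (auto simp: sorted_append nth_append less_Suc_eq)
  have "Suc i = length (l @ [c]) \<longleftrightarrow> i = length l" for i by simp
  then show "region (l @ [c]) (u @ [last u]) - right_column (region (l @ [c]) (u @ [last u])) = region l u"
    unfolding right_column_region[OF st'] using std(3)
    by (auto simp: region_def nth_append less_Suc_eq split: if_splits)
qed

text \<open>Converse to adding a row. Deleting the top row cuts every column at height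
  \<open>last u' - 1\<close>; by the size hypothesis no column disappears and the height drops by
  exactly one, so \<open>raise\<close> undoes the cut.\<close>

lemma delete_top_row_cases:
  assumes st': "stair l' u'" and st: "stair l u"
    and del: "region l' u' - top_row (region l' u') = region l u"
    and size: "psize (region l' u') = Suc (psize (region l u))"
  obtains w where "l' = l" "u' = raise w u" "1 \<le> w" "w \<le> top_width u"
proof -
  note s = stairD[OF st] and s' = stairD[OF st']
  have su: "sorted u" and su': "sorted u'" using st st' by (simp_all add: stair_def)
  have mem: "i < length l \<and> l ! i \<le> j \<and> j < u ! i \<longleftrightarrow>
      i < length l' \<and> l' ! i \<le> j \<and> j < min (u' ! i) (last u' - 1)" for i j
  proof -
    have "(i, j) \<in> region l u \<longleftrightarrow> (i, j) \<in> region l' u' \<and> \<not> (u' ! i = last u' \<and> Suc j = last u')"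
      unfolding del[symmetric] top_row_region[OF st'] by (auto simp: region_def)
    then have "(i, j) \<in> region l u \<longleftrightarrow> i < length l' \<and> l' ! i \<le> j \<and> j < min (u' ! i) (last u' - 1)"
      using s'(12)[of i] by (auto simp: region_def)
    then show ?thesis by (simp add: region_def)
  qed
  have len_le: "length l \<le> length l'"
  proof -
    have "length l - 1 < length l'"
      using mem[of "length l - 1" "l ! (length l - 1)"] s(4) s(6)[of "length l - 1"] by simp
    then show ?thesis by simp
  qed
  moreover have "last u < last u'"
  proof -
    have "l ! (length l - 1) \<le> last u - 1" "last u - 1 < u ! (length l - 1)"
      using s(10,11,13) by linarith+
    then have "last u - 1 < last u' - 1"
      using mem[of "length l - 1" "last u - 1"] s(4) by simp
    then show ?thesis by simp
  qed
  \<comment> \<open>The width does not grow and the height strictly drops under the deletion; a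
    total loss of one leaves a single possibility.\<close>
  ultimately have len: "length l' = length l" and last: "last u' = Suc (last u)"
    using size unfolding psize_region[OF st] psize_region[OF st'] using s(4) s(13) by linarith+
  have eq: "l' ! i = l ! i \<and> min (u' ! i) (last u) = u ! i" if "i < length l" for i
  proof -
    have "j \<in> {l ! i..<u ! i} \<longleftrightarrow> j \<in> {l' ! i..<min (u' ! i) (last u)}" for j
      using mem[of i j] that len last by simp
    then have "{l ! i..<u ! i} = {l' ! i..<min (u' ! i) (last u)}" by blast
    moreover have "l' ! i < min (u' ! i) (last u)"
      using mem[of i "l ! i"] s(6)[OF that] that last by simp
    ultimately show ?thesis
      using atLeastLessThan_eq_iff[OF s(6)[OF that], of "l' ! i"] by metis
  qed
  have l: "l' = l" using eq len by (intro nth_equalityI) simp_all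
  \<comment> \<open>The width of the deleted row.\<close>
  define w where "w = top_width u'"
  have w: "w \<le> length u'" "\<And>i. i < length u' \<Longrightarrow> length u' - w \<le> i \<Longrightarrow> u' ! i = last u'"
    using top_width_iff[OF su' s'(2), of w] by (auto simp: w_def)
  have lens: "length u' = length l" "length u = length l" using s(3) s'(3) len by auto
  have w1: "1 \<le> w"
  proof -
    have "u' ! i = last u'" if "i < length u'" "length u' - 1 \<le> i" for i
    proof -
      have "i = length l' - 1" using that lens len by simp
      then show ?thesis using s'(11) by simp
    qed
    moreover have "1 \<le> length u'" using s(4) lens by linarith
    ultimately show ?thesis
      unfolding w_def top_width_iff[OF su' s'(2)] by blast
  qed
  have lt: "u' ! i \<noteq> last u'" if i: "i < length l - w" for i
  proof
    assume a: "u' ! i = last u'"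
    have "u' ! j = last u'" if "j < length u'" "length u' - (length l - i) \<le> j" for j
    proof -
      have "i \<le> j" "j < length l'" using that i lens len by linarith+
      then show ?thesis using s'(9)[of i j] s'(12)[of j] a by linarith
    qed
    then have "length l - i \<le> top_width u'"
      unfolding top_width_iff[OF su' s'(2)] using lens by auto
    then show False using i by (simp add: w_def)
  qed
  have "u' ! i = raise w u ! i" if i: "i < length l" for i
  proof (cases "i < length l - w")
    case True
    then have "u' ! i \<le> last u" using lt[OF True] s'(12)[of i] i last len by simp
    then show ?thesis using True eq[OF i] i lens w(1) by (simp add: nth_raise)
  next
    case False
    then show ?thesis using w(2)[of i] i lens w(1) last by (simp add: nth_raise)
  qed
  then have u: "u' = raise w u"
    using lens w(1) by (intro nth_equalityI) (simp_all add: length_raise)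
  have "u ! i = last u" if "i < length u" "length u - w \<le> i" for i
    using eq[of i] w(2)[of i] that lens last by simp
  then have "w \<le> top_width u"
    unfolding top_width_iff[OF su s(2)] using w(1) lens by auto
  then show thesis using that l u w1 by blast
qed

text \<open>The deletion removes the last entry of both lists. The lost column already accounts for
  the loss of one in size, so the top height is unchanged and the deleted column ended at
  \<open>last u\<close>.\<close>

lemma delete_right_column_cases:
  assumes st': "stair l' u'" and st: "stair l u"
    and del: "region l' u' - right_column (region l' u') = region l u"
    and size: "psize (region l' u') = Suc (psize (region l u))"
  obtains c where "l' = l @ [c]" "u' = u @ [last u]" "last l \<le> c" "c < last u"
proof -
  note s = stairD[OF st] and s' = stairD[OF st']
  have bl: "butlast l' ! i = l' ! i" "butlast u' ! i = u' ! i" if "i < length l' - 1" for i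
    using that s'(3) by (simp_all add: nth_butlast)
  have r: "region (butlast l') (butlast u') = region l u"
    unfolding del[symmetric] right_column_region[OF st']
    using s'(4,10,11) bl by (auto simp: region_def dest: less_SucI) (metis One_nat_def diff_Suc_1 less_antisym less_imp_Suc_add)+
  have ne: "butlast l' \<noteq> []"
  proof
    assume "butlast l' = []"
    then have "region l u = {}" using r by (simp add: region_def)
    then show False using corner_in_top_row_right_column[OF st] by (auto simp: top_row_def)
  qed
  have "stair (butlast l') (butlast u')"
    unfolding stair_def using st' ne bl bl(1)[of 0] s'
    by (auto simp: stair_def sorted_butlast simp flip: length_greater_0_conv)
  then have bls: "butlast l' = l" "butlast u' = u"
    using region_inject[OF _ st r] by auto
  have len: "length l' = Suc (length l)" using bls(1) s'(4) by auto
  have last: "last u' = last u"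
    using size len s(4,13) s'(13) by (simp add: psize_region st st')
  have "l' = l @ [last l']" "u' = u @ [last u]"
    using bls s'(1,2) last by (metis append_butlast_last_id)+
  moreover have "last l \<le> last l'"
    using s'(8)[of "length l - 1" "length l"] s'(10) s(4,10) len bl(1)[of "length l - 1"] bls by simp
  moreover have "last l' < last u" using s'(13) last by simp
  ultimately show thesis using that by blast
qed

section \<open>Slicings as words\<close>

text \<open>In a word the last block comes first. A row is given by its width, a column by the height of
  its lower end above the \<open>x\<close>-axis.\<close>

datatype move = Row nat | Col nat

fun lows :: "move list \<Rightarrow> nat list" where
  "lows [] = [0]"
| "lows (Row w # v) = lows v"
| "lows (Col c # v) = lows v @ [c]"

fun ups :: "move list \<Rightarrow> nat list" where
  "ups [] = [1]"
| "ups (Row w # v) = raise w (ups v)"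
| "ups (Col c # v) = ups v @ [last (ups v)]"

definition shape :: "move list \<Rightarrow> cell set" where
  "shape v = region (lows v) (ups v)"

fun blocks :: "move list \<Rightarrow> block set" where
  "blocks [] = {Single {(0, 0)}}"
| "blocks (Row w # v) = insert (Horizontal (top_row (shape (Row w # v)))) (blocks v)"
| "blocks (Col c # v) = insert (Vertical (right_column (shape (Col c # v)))) (blocks v)"

fun proper :: "move list \<Rightarrow> bool" where
  "proper [] \<longleftrightarrow> True"
| "proper (Row w # v) \<longleftrightarrow> proper v \<and> 1 \<le> w \<and> w \<le> top_width (ups v)"
| "proper (Col c # v) \<longleftrightarrow> proper v \<and> last (lows v) \<le> c \<and> c < last (ups v)"

lemma stair_proper: "proper v \<Longrightarrow> stair (lows v) (ups v)"
proof (induction v rule: proper.induct)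
  case 1
  show ?case by (simp add: stair_def)
qed (auto intro: stair_raise stair_snoc)

lemma shape_Nil: "shape [] = {(0, 0)}"
  by (auto simp: shape_def region_def)

lemma shape_Row_minus:
  "proper (Row w # v) \<Longrightarrow> shape (Row w # v) - top_row (shape (Row w # v)) = shape v"
  using region_raise_minus[OF stair_proper[of v]] by (simp add: shape_def)

lemma shape_Col_minus:
  "proper (Col c # v) \<Longrightarrow> shape (Col c # v) - right_column (shape (Col c # v)) = shape v"
  using region_snoc_minus[OF stair_proper[of v]] by (simp add: shape_def)

lemma psize_shape: "proper v \<Longrightarrow> psize (shape v) = Suc (length v)"
proof (induction v rule: proper.induct)
  case 1
  then show ?case by (simp add: shape_def psize_region stair_proper[of "[]", simplified])
next
  case (2 w v)
  then show ?case
    using stairD(4,13)[OF stair_proper, of v]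
      psize_region[OF stair_proper[OF "2.prems"]] psize_region[OF stair_proper, of v]
    by (simp add: shape_def last_raise)
next
  case (3 c v)
  then show ?case
    using stairD(4,13)[OF stair_proper, of v]
      psize_region[OF stair_proper[OF "3.prems"]] psize_region[OF stair_proper, of v]
    by (simp add: shape_def)
qed

lemma baxter_slicing_proper:
  "proper v \<Longrightarrow> baxter_slicing (Suc (length v)) (shape v) (blocks v)"
proof (induction v rule: proper.induct)
  case 1
  show ?case using baxter_slicing.single by (simp add: shape_Nil)
next
  case (2 w v)
  have "parallelogram_polyomino (shape (Row w # v))"
    unfolding parallelogram_polyomino_iff shape_def using stair_proper[OF "2.prems"] by blast
  moreover have "baxter_slicing (Suc (length v)) (shape (Row w # v) - top_row (shape (Row w # v))) (blocks v)"
    using 2 shape_Row_minus[OF "2.prems"] by simp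
  ultimately show ?case
    using baxter_slicing.horizontal psize_shape[OF "2.prems"] by simp
next
  case (3 c v)
  have "parallelogram_polyomino (shape (Col c # v))"
    unfolding parallelogram_polyomino_iff shape_def using stair_proper[OF "3.prems"] by blast
  moreover have "baxter_slicing (Suc (length v)) (shape (Col c # v) - right_column (shape (Col c # v))) (blocks v)"
    using 3 shape_Col_minus[OF "3.prems"] by simp
  ultimately show ?case
    using baxter_slicing.vertical psize_shape[OF "3.prems"] by simp
qed

text \<open>Together with \<open>baxter_slicing_proper\<close> this shows that slicings are exactly
  what proper words describe; the two deletion lemmas supply the last move.\<close>

lemma baxter_slicing_cases:
  "baxter_slicing n P B \<Longrightarrow> \<exists>v. proper v \<and> n = Suc (length v) \<and> P = shape v \<and> B = blocks v"
proof (induction rule: baxter_slicing.induct)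
  case single
  show ?case by (rule exI[of _ "[]"]) (simp add: shape_Nil)
next
  case (horizontal P n B)
  then obtain v where v: "proper v" "n = Suc (length v)" "P - top_row P = shape v" "B = blocks v"
    by blast
  obtain l' u' where P: "stair l' u'" "P = region l' u'"
    using horizontal.hyps(1) by (auto simp: parallelogram_polyomino_iff)
  have "psize P = Suc (psize (shape v))"
    using horizontal.hyps(2) v psize_shape by simp
  then obtain w where w: "l' = lows v" "u' = raise w (ups v)" "1 \<le> w" "w \<le> top_width (ups v)"
    using delete_top_row_cases[OF P(1) stair_proper[OF v(1)]] v(3) unfolding P(2) shape_def by metis
  then show ?case
    using v P by (intro exI[of _ "Row w # v"]) (simp add: shape_def)
next
  case (vertical P n B)
  then obtain v where v: "proper v" "n = Suc (length v)" "P - right_column P = shape v" "B = blocks v"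
    by blast
  obtain l' u' where P: "stair l' u'" "P = region l' u'"
    using vertical.hyps(1) by (auto simp: parallelogram_polyomino_iff)
  have "psize P = Suc (psize (shape v))"
    using vertical.hyps(2) v psize_shape by simp
  then obtain c where c: "l' = lows v @ [c]" "u' = ups v @ [last (ups v)]"
      "last (lows v) \<le> c" "c < last (ups v)"
    using delete_right_column_cases[OF P(1) stair_proper[OF v(1)]] v(3) unfolding P(2) shape_def
    by metis
  then show ?case
    using v P by (intro exI[of _ "Col c # v"]) (simp add: shape_def)
qed

section \<open>Recovering a word from its slicing\<close>

lemma corner_in_shape:
  assumes "proper v"
  shows "top_row (shape v) \<inter> right_column (shape v) \<noteq> {}"
  using corner_in_top_row_right_column[OF stair_proper[OF assms]] by (auto simp: shape_def)

text \<open>A newly added row or column is disjoint from the previous shape. Earlier blocks are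
  non-empty parts of that shape, so the new block differs from all of them.\<close>

lemma block_subset_shape:
  assumes "proper v"
  shows "Horizontal b \<in> blocks v \<Longrightarrow> b \<subseteq> shape v \<and> b \<noteq> {}"
    and "Vertical b \<in> blocks v \<Longrightarrow> b \<subseteq> shape v \<and> b \<noteq> {}"
proof -
  have "(Horizontal b \<in> blocks v \<longrightarrow> b \<subseteq> shape v \<and> b \<noteq> {}) \<and>
      (Vertical b \<in> blocks v \<longrightarrow> b \<subseteq> shape v \<and> b \<noteq> {})"
    using assms
  proof (induction v rule: proper.induct)
    case 1
    show ?case by simp
  next
    case (2 w v)
    have "shape v \<subseteq> shape (Row w # v)" using shape_Row_minus[OF "2.prems"] by blast
    moreover have "top_row (shape (Row w # v)) \<subseteq> shape (Row w # v)" by (auto simp: top_row_def)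
    moreover have "top_row (shape (Row w # v)) \<noteq> {}" using corner_in_shape[OF "2.prems"] by blast
    ultimately show ?case using 2 by auto
  next
    case (3 c v)
    have "shape v \<subseteq> shape (Col c # v)" using shape_Col_minus[OF "3.prems"] by blast
    moreover have "right_column (shape (Col c # v)) \<subseteq> shape (Col c # v)"
      by (auto simp: right_column_def)
    moreover have "right_column (shape (Col c # v)) \<noteq> {}" using corner_in_shape[OF "3.prems"] by blast
    ultimately show ?case using 3 by auto
  qed
  then show "Horizontal b \<in> blocks v \<Longrightarrow> b \<subseteq> shape v \<and> b \<noteq> {}"
    and "Vertical b \<in> blocks v \<Longrightarrow> b \<subseteq> shape v \<and> b \<noteq> {}" by blast+
qed

lemma new_row_not_in_blocks:
  assumes "proper (Row w # v)"
  shows "Horizontal (top_row (shape (Row w # v))) \<notin> blocks v"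
  using block_subset_shape(1)[of v "top_row (shape (Row w # v))"] assms shape_Row_minus[OF assms]
  by auto

lemma new_column_not_in_blocks:
  assumes "proper (Col c # v)"
  shows "Vertical (right_column (shape (Col c # v))) \<notin> blocks v"
  using block_subset_shape(2)[of v "right_column (shape (Col c # v))"] assms shape_Col_minus[OF assms]
  by auto

text \<open>If the block sets agreed, the last row of the first word would be an earlier block of
  the second and so avoid the right column, but both contain the top right cell.\<close>

lemma Row_Col_distinct:
  assumes "proper (Row w # v)" "proper (Col c # v')" "shape (Row w # v) = shape (Col c # v')"
  shows "blocks (Row w # v) \<noteq> blocks (Col c # v')"
proof
  assume "blocks (Row w # v) = blocks (Col c # v')"
  then have "Horizontal (top_row (shape (Row w # v))) \<in> blocks v'" by auto
  then have "top_row (shape (Row w # v)) \<subseteq> shape v'"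
    using block_subset_shape(1) assms(2) by simp
  then have "top_row (shape (Row w # v)) \<inter> right_column (shape (Row w # v)) = {}"
    unfolding shape_Col_minus[OF assms(2), symmetric] assms(3) by blast
  then show False
    using corner_in_shape[OF assms(1)] by simp
qed

text \<open>The kind of the last move is fixed by \<open>Row_Col_distinct\<close>, and the last
  block is the top row or right column of the common shape. It is not among the earlier blocks, so
  it cancels from both block sets and the induction hypothesis applies to the rest.\<close>

lemma shape_blocks_inject:
  assumes "proper v" "proper v'" "shape v = shape v'" "blocks v = blocks v'"
  shows "v = v'"
  using assms
proof (induction v arbitrary: v' rule: proper.induct)
  case 1
  have "length v' = 0"
    using arg_cong[OF "1.prems"(3), of psize]
    unfolding psize_shape[OF "1.prems"(1)] psize_shape[OF "1.prems"(2)] by simp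
  then show ?case by simp
next
  case (2 w v)
  have "length v' = Suc (length v)"
    using arg_cong[OF "2.prems"(3), of psize]
    unfolding psize_shape[OF "2.prems"(1)] psize_shape[OF "2.prems"(2)] by simp
  then obtain m v'' where v': "v' = m # v''" by (cases v') auto
  have "m \<noteq> Col c" for c
    using Row_Col_distinct[of w v c v''] "2.prems" v' by metis
  then obtain w' where m: "m = Row w'" by (cases m) auto
  note p = "2.prems"[unfolded v' m]
  have "shape v = shape v''"
    using shape_Row_minus[OF p(1)] shape_Row_minus[OF p(2)] p(3) by simp
  moreover have "blocks v = blocks v''"
    using insert_ident[OF new_row_not_in_blocks[OF p(1)]
        new_row_not_in_blocks[OF p(2), folded p(3)]] p(4)
    unfolding blocks.simps p(3) by simp
  ultimately have v: "v = v''" using "2.IH"[of v''] p(1,2) by simp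
  have "w = w'"
  proof -
    \<comment> \<open>The width of the last row is the number of cells in the common top
      row.\<close>
    have "card (top_row (shape (Row x # v))) = x" if "proper (Row x # v)" for x
    proof -
      have "x \<le> length (lows v)"
        using that top_width_iff[of "ups v" x] stair_proper[of v] stairD(2,3)[OF stair_proper, of v]
        by (auto simp: stair_def)
      then show ?thesis
        using that by (simp add: shape_def top_row_raise stair_proper card_image inj_on_def)
    qed
    then show ?thesis using p v by metis
  qed
  then show ?case using v' m v by simp
next
  case (3 c v)
  have "length v' = Suc (length v)"
    using arg_cong[OF "3.prems"(3), of psize]
    unfolding psize_shape[OF "3.prems"(1)] psize_shape[OF "3.prems"(2)] by simp
  then obtain m v'' where v': "v' = m # v''" by (cases v') auto
  have "m \<noteq> Row w" for w
    using Row_Col_distinct[of w v'' c v] "3.prems" v' by metis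
  then obtain c' where m: "m = Col c'" by (cases m) auto
  note p = "3.prems"[unfolded v' m]
  have "shape v = shape v''"
    using shape_Col_minus[OF p(1)] shape_Col_minus[OF p(2)] p(3) by simp
  moreover have "blocks v = blocks v''"
    using insert_ident[OF new_column_not_in_blocks[OF p(1)]
        new_column_not_in_blocks[OF p(2), folded p(3)]] p(4)
    unfolding blocks.simps p(3) by simp
  ultimately have v: "v = v''" using "3.IH"[of v''] p(1,2) by simp
  moreover have "c = c'"
    using region_inject[OF stair_proper[OF p(1)] stair_proper[OF p(2)]] p(3) v by (simp add: shape_def)
  ultimately show ?case using v' m by simp
qed

text \<open>\<open>C l x\<close> bounds the width of a row whose right edge has abscissa \<open>x\<close>, given the column bottoms
  \<open>l\<close>. It must not depend on columns to the right of \<open>x\<close>, so that a bound met when a row is added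
  remains met later.\<close>

fun restricted :: "(nat list \<Rightarrow> nat \<Rightarrow> nat) \<Rightarrow> move list \<Rightarrow> bool" where
  "restricted C [] \<longleftrightarrow> True"
| "restricted C (Row w # v) \<longleftrightarrow> restricted C v \<and> w \<le> C (lows v) (length (lows v))"
| "restricted C (Col c # v) \<longleftrightarrow> restricted C v"

section \<open>Row bounds along a word\<close>

lemma right_end_le:
  assumes "proper v" "Horizontal b \<in> blocks v"
  shows "Suc (Max (fst ` b)) \<le> length (lows v)"
proof -
  have b: "b \<subseteq> shape v" "b \<noteq> {}" using block_subset_shape(1)[OF assms] by auto
  have "finite b" using b(1) finite_region finite_subset unfolding shape_def by blast
  then have "Max (fst ` b) \<in> fst ` b" using b(2) by simp
  also have "fst ` b \<subseteq> {..<length (lows v)}"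
    using b(1) fst_region[OF stair_proper[OF assms(1)]] unfolding shape_def by blast
  finally show ?thesis by simp
qed

lemma new_row_extent:
  assumes "proper (Row w # v)"
  shows "width (top_row (shape (Row w # v))) = w"
    and "Suc (Max (fst ` top_row (shape (Row w # v)))) = length (lows v)"
proof -
  have st: "stair (lows v) (ups v)" using assms stair_proper by simp
  have w: "1 \<le> w" "w \<le> top_width (ups v)" using assms by auto
  have "w \<le> length (lows v)"
    using w(2) top_width_iff[of "ups v" w] st stairD(2,3)[OF st] by (simp add: stair_def)
  define M where "M = length (lows v)"
  have wM: "w \<le> M" using \<open>w \<le> length (lows v)\<close> by (simp add: M_def)
  have "fst ` top_row (shape (Row w # v)) = {M - w..<M}"
    unfolding shape_def lows.simps ups.simps top_row_raise[OF st w] image_image M_def by simp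
  moreover have "Max {M - w..<M} = M - 1" "Min {M - w..<M} = M - w"
    using w(1) wM by (auto intro!: Max_eqI Min_eqI)
  ultimately show "width (top_row (shape (Row w # v))) = w"
    and "Suc (Max (fst ` top_row (shape (Row w # v)))) = length (lows v)"
    using w(1) wM by (simp_all add: width_def M_def[symmetric])
qed

text \<open>On the left the bound is evaluated at the final column bottoms, on the right at those
  present when the row was added. Rows leave the bottoms alone, and later columns lie to the right
  of the row's right edge, so \<open>stable\<close> applies.\<close>

lemma restricted_iff:
  assumes stable: "\<And>l c x. 0 < x \<Longrightarrow> x \<le> length l \<Longrightarrow> C (l @ [c]) x = C l x"
    and "proper v"
  shows "(\<forall>b. Horizontal b \<in> blocks v \<longrightarrow> width b \<le> C (lows v) (Suc (Max (fst ` b)))) \<longleftrightarrow>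
    restricted C v"
  using assms(2)
proof (induction v rule: proper.induct)
  case 1
  show ?case by simp
next
  case (2 w v)
  then show ?case
    using new_row_extent[OF "2.prems"] by auto
next
  case (3 c v)
  have "C (lows v @ [c]) (Suc (Max (fst ` b))) = C (lows v) (Suc (Max (fst ` b)))"
    if "Horizontal b \<in> blocks v" for b
    using right_end_le[of v b] that 3 by (intro stable) simp_all
  then show ?case using 3 by auto
qed

definition words :: "(nat list \<Rightarrow> nat \<Rightarrow> nat) \<Rightarrow> nat \<Rightarrow> move list set" where
  "words C n = {v. length v = n \<and> proper v \<and> restricted C v}"

text \<open>Serves both families: \<open>C\<close> will be the constant 2 or
  \<open>run_length\<close>, and \<open>bnd\<close> the same bound read off the polyomino.\<close>

lemma card_slicings:
  assumes stable: "\<And>l c x. 0 < x \<Longrightarrow> x \<le> length l \<Longrightarrow> C (l @ [c]) x = C l x"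
    and bound: "\<And>v b. proper v \<Longrightarrow> Horizontal b \<in> blocks v \<Longrightarrow>
      bnd (shape v) b = C (lows v) (Suc (Max (fst ` b)))"
  shows "card {(P, B). baxter_slicing (Suc n) P B \<and> (\<forall>b. Horizontal b \<in> B \<longrightarrow> width b \<le> bnd P b)} =
    card (words C n)"
proof -
  have iff: "(\<forall>b. Horizontal b \<in> blocks v \<longrightarrow> width b \<le> bnd (shape v) b) \<longleftrightarrow> restricted C v"
    if "proper v" for v
  proof -
    have "(\<forall>b. Horizontal b \<in> blocks v \<longrightarrow> width b \<le> C (lows v) (Suc (Max (fst ` b)))) \<longleftrightarrow>
        restricted C v"
      by (rule restricted_iff[where C = C]) (use stable that in auto)
    then show ?thesis using bound[OF that] by simp
  qed
  have "{(P, B). baxter_slicing (Suc n) P B \<and> (\<forall>b. Horizontal b \<in> B \<longrightarrow> width b \<le> bnd P b)} =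
      (\<lambda>v. (shape v, blocks v)) ` words C n"
  proof (intro set_eqI iffI; clarify)
    fix P B
    assume "baxter_slicing (Suc n) P B" "\<forall>b. Horizontal b \<in> B \<longrightarrow> width b \<le> bnd P b"
    moreover from this obtain v where "proper v" "n = length v" "P = shape v" "B = blocks v"
      using baxter_slicing_cases by blast
    ultimately show "(P, B) \<in> (\<lambda>v. (shape v, blocks v)) ` words C n"
      using iff[of v] by (intro image_eqI[of _ _ v]) (simp_all add: words_def)
  next
    fix v assume "v \<in> words C n"
    then show "baxter_slicing (Suc n) (shape v) (blocks v) \<and>
        (\<forall>b. Horizontal b \<in> blocks v \<longrightarrow> width b \<le> bnd (shape v) b)"
      using iff[of v] baxter_slicing_proper[of v] by (simp add: words_def)
  qed
  moreover have "inj_on (\<lambda>v. (shape v, blocks v)) (words C n)"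
    by (rule inj_onI) (auto simp: words_def intro: shape_blocks_inject)
  ultimately show ?thesis by (simp add: card_image)
qed

section \<open>Counting words\<close>

text \<open>The first component \<open>h\<close> of the label; the second component \<open>k\<close>
  is \<open>last (ups v) - last (lows v)\<close>.\<close>

definition row_bound :: "(nat list \<Rightarrow> nat \<Rightarrow> nat) \<Rightarrow> move list \<Rightarrow> nat" where
  "row_bound C v = min (top_width (ups v)) (C (lows v) (length (lows v)))"

definition extensions :: "(nat list \<Rightarrow> nat \<Rightarrow> nat) \<Rightarrow> move list \<Rightarrow> move set" where
  "extensions C v = Row ` {1..row_bound C v} \<union> Col ` {last (lows v)..<last (ups v)}"

lemma words_0: "words C 0 = {[]}"
  by (auto simp: words_def)

lemma words_Suc: "words C (Suc n) = (\<lambda>(v, m). m # v) ` Sigma (words C n) (extensions C)"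
proof (rule set_eqI)
  fix x
  show "x \<in> words C (Suc n) \<longleftrightarrow> x \<in> (\<lambda>(v, m). m # v) ` Sigma (words C n) (extensions C)"
  proof (cases x)
    case Nil
    then show ?thesis by (auto simp: words_def)
  next
    case (Cons m v)
    then show ?thesis
      by (cases m) (auto simp: words_def extensions_def row_bound_def image_iff)
  qed
qed

lemma finite_extensions: "finite (extensions C v)"
  by (simp add: extensions_def)

lemma finite_words: "finite (words C n)"
  by (induction n) (simp_all add: words_0 words_Suc finite_extensions)

lemma sum_extensions:
  fixes f :: "move \<Rightarrow> 'a::comm_monoid_add"
  shows "sum f (extensions C v) = (\<Sum>w=1..row_bound C v. f (Row w)) +
    (\<Sum>c\<in>{last (lows v)..<last (ups v)}. f (Col c))"
  unfolding extensions_def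
  by (subst sum.union_disjoint) (auto simp: sum.reindex inj_on_def)

lemma sum_words_Suc:
  fixes f :: "move list \<Rightarrow> 'a::comm_monoid_add"
  shows "sum f (words C (Suc n)) = (\<Sum>v\<in>words C n. \<Sum>m\<in>extensions C v. f (m # v))"
proof -
  have "inj_on (\<lambda>(v, m). m # v) (Sigma (words C n) (extensions C))"
    by (auto simp: inj_on_def)
  then show ?thesis
    unfolding words_Suc
    by (simp add: sum.reindex sum.Sigma finite_words finite_extensions case_prod_unfold)
qed

unbundle fps_syntax

text \<open>The hypothesis is the recursion for counting the descendants of \<open>v\<close> by the
  number of added moves. Each unfolding lengthens the words by one and lowers the coefficient index
  by one; at index 0 every word contributes 1.\<close>

lemma card_words:
  fixes \<phi> :: "move list \<Rightarrow> rat fps"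
  assumes \<phi>: "\<And>v. proper v \<Longrightarrow> \<phi> v = 1 + fps_X * (\<Sum>m\<in>extensions C v. \<phi> (m # v))"
  shows "of_nat (card (words C n)) = \<phi> [] $ n"
proof -
  have "(\<Sum>v\<in>words C n. \<phi> v $ k) = \<phi> [] $ (n + k)" for k
  proof (induction n arbitrary: k)
    case 0
    show ?case by (simp add: words_0)
  next
    case (Suc n)
    have "(\<Sum>m\<in>extensions C v. \<phi> (m # v) $ k) = \<phi> v $ Suc k" if "v \<in> words C n" for v
    proof -
      have "\<phi> v = 1 + fps_X * (\<Sum>m\<in>extensions C v. \<phi> (m # v))"
        using \<phi> that by (simp add: words_def)
      then have "\<phi> v $ Suc k = (1 + fps_X * (\<Sum>m\<in>extensions C v. \<phi> (m # v))) $ Suc k"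
        by (rule arg_cong)
      then show ?thesis by (simp add: fps_sum_nth)
    qed
    then show ?case
      using Suc.IH[of "Suc k"] by (simp add: sum_words_Suc)
  qed
  from this[of 0] have "(\<Sum>v\<in>words C n. \<phi> v $ 0) = \<phi> [] $ n" by simp
  moreover have "\<phi> v $ 0 = 1" if "v \<in> words C n" for v
  proof -
    have "\<phi> v = 1 + fps_X * (\<Sum>m\<in>extensions C v. \<phi> (m # v))"
      using \<phi> that by (simp add: words_def)
    then have "\<phi> v $ 0 = (1 + fps_X * (\<Sum>m\<in>extensions C v. \<phi> (m # v))) $ 0"
      by (rule arg_cong)
    then show ?thesis by simp
  qed
  ultimately show ?thesis by simp
qed

section \<open>Labels of the children of a node\<close>

lemma top_width_raise:
  assumes "1 \<le> w" "w \<le> length u" "\<And>x. x \<in> set u \<Longrightarrow> x \<le> last u"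
  shows "top_width (raise w u) = w"
proof -
  have "i < length u \<and> raise w u ! i = Suc (last u) \<longleftrightarrow> length u - w \<le> i \<and> i < length u" for i
    using assms(2) assms(3)[of "u ! i"] by (cases "i < length u - w") (auto simp: nth_raise)
  then have "{i. i < length u \<and> raise w u ! i = Suc (last u)} = {length u - w..<length u}"
    by (simp only: atLeastLessThan_def lessThan_def atLeast_def Collect_conj_eq[symmetric])
  then show ?thesis
    using assms(1,2) by (simp add: top_width_def length_raise last_raise)
qed

lemma top_width_snoc: "top_width (u @ [last u]) = Suc (top_width u)"
proof -
  have "{i. i < length (u @ [last u]) \<and> (u @ [last u]) ! i = last (u @ [last u])} =
      insert (length u) {i. i < length u \<and> u ! i = last u}"
    by (auto simp: nth_append less_Suc_eq)
  then show ?thesis by (simp add: top_width_def)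
qed

lemma top_width_pos:
  assumes "u \<noteq> []"
  shows "1 \<le> top_width u"
proof -
  have "length u - 1 \<in> {i. i < length u \<and> u ! i = last u}"
    using assms by (simp add: last_conv_nth)
  then have "{i. i < length u \<and> u ! i = last u} \<noteq> {}" by blast
  then show ?thesis unfolding top_width_def by (simp add: Suc_le_eq card_gt_0_iff)
qed

lemma run_length_snoc: "0 < x \<Longrightarrow> x \<le> length l \<Longrightarrow> run_length (l @ [c]) x = run_length l x"
  unfolding run_length_def by (rule arg_cong[of _ _ card]) (auto simp: nth_append)

text \<open>A new column at the old bottom prolongs the final horizontal run of the lower border; a
  higher bottom starts a new run.\<close>

lemma run_length_snoc_end:
  assumes "l \<noteq> []" "\<And>x. x \<in> set l \<Longrightarrow> x \<le> last l" "last l \<le> c"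
  shows "run_length (l @ [c]) (Suc (length l)) =
    (if c = last l then Suc (run_length l (length l)) else 1)"
proof (cases "c = last l")
  case True
  have "{i. i < Suc (length l) \<and> (l @ [c]) ! i = c} = insert (length l) {i. i < length l \<and> l ! i = c}"
    by (auto simp: nth_append less_Suc_eq)
  then show ?thesis using True assms(1) by (simp add: run_length_def last_conv_nth)
next
  case False
  have "l ! i < c" if "i < length l" for i
    using assms(2)[of "l ! i"] assms(3) that False by simp
  then have "{i. i < Suc (length l) \<and> (l @ [c]) ! i = c} = {length l}"
    by (force simp: nth_append less_Suc_eq)
  then show ?thesis using False by (simp add: run_length_def)
qed

lemma set_le_last:
  assumes "stair l u"
  shows "x \<in> set l \<Longrightarrow> x \<le> last l" "x \<in> set u \<Longrightarrow> x \<le> last u"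
proof -
  note st = stairD[OF assms]
  show "x \<le> last l" if x: "x \<in> set l"
  proof -
    obtain i where "i < length l" "x = l ! i" using x by (auto simp: in_set_conv_nth)
    then show ?thesis unfolding st(10) using st(8)[of i "length l - 1"] by simp
  qed
  show "x \<le> last u" if x: "x \<in> set u"
  proof -
    obtain i where "i < length u" "x = u ! i" using x by (auto simp: in_set_conv_nth)
    then show ?thesis using st(3) st(12)[of i] by simp
  qed
qed

text \<open>The new top row has width \<open>w\<close>, and the bottoms are unchanged, so the bound
  \<open>C\<close> is still at least \<open>w\<close> and the minimum is \<open>w\<close>.\<close>

lemma row_bound_Row:
  assumes "proper (Row w # v)" "w \<le> C (lows v) (length (lows v))"
  shows "row_bound C (Row w # v) = w"
proof -
  have st: "stair (lows v) (ups v)" using assms stair_proper by simp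
  have "w \<le> length (ups v)"
    using assms top_width_iff[of "ups v" w] st stairD(2)[OF st] by (simp add: stair_def)
  then show ?thesis
    using assms top_width_raise set_le_last[OF st] by (simp add: row_bound_def)
qed

text \<open>\<open>W\<close> is the compositional inverse of \<open>X / ((1 + X) (1 + X + X\<^sup>2))\<close>.\<close>

lemma fps_kernel_exists:
  obtains W :: "rat fps" where "W = fps_X * (1 + W) * (1 + W + W\<^sup>2)"
proof -
  define D :: "rat fps" where "D = (1 + fps_X) * (1 + fps_X + fps_X * fps_X)"
  have D0: "D $ 0 \<noteq> 0" by (simp add: D_def)
  define P where "P = fps_X * inverse D"
  have P: "P $ 0 = 0" "P $ 1 \<noteq> 0" using D0 by (simp_all add: P_def)
  define W where "W = fps_inv P"
  have W0: "W $ 0 = 0" by (simp add: W_def fps_inv_def)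
  have "P * D = fps_X" using D0 by (simp add: P_def mult.assoc inverse_mult_eq_1)
  \<comment> \<open>Composition with \<open>W\<close>, the inverse of \<open>P\<close>, turns the
    factor \<open>P\<close> into \<open>fps_X\<close> and the right-hand side into
    \<open>W\<close>.\<close>
  then have "(P * D) oo W = fps_X oo W" by simp
  then have "(P oo W) * (D oo W) = W"
    using W0 by (simp add: fps_compose_mult_distrib fps_X_fps_compose_startby0)
  moreover have "P oo W = fps_X" using fps_inv_right[OF P] by (simp add: W_def)
  moreover have "D oo W = (1 + W) * (1 + W + W\<^sup>2)"
    using W0 by (simp add: D_def fps_compose_mult_distrib fps_compose_add_distrib
        fps_X_fps_compose_startby0 power2_eq_square)
  ultimately have "W = fps_X * (1 + W) * (1 + W + W\<^sup>2)" by (simp add: mult.assoc)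
  then show thesis by (rule that)
qed

section \<open>Kernel identities\<close>

lemma affine_step:
  fixes A B P Q X :: "'a::comm_ring_1"
  assumes "A = 1 + X * P" "B - A = X * (Q - P)"
  shows "B = 1 + X * Q"
proof -
  have "B = A + (B - A)" by simp
  also have "\<dots> = 1 + X * P + X * (Q - P)" unfolding assms(2) using assms(1) by simp
  also have "\<dots> = 1 + X * Q" by (simp add: algebra_simps)
  finally show ?thesis .
qed

text \<open>Each identity is reached from a simpler instance by \<open>affine_step\<close>, which
  asks only for the difference of the two. The algebra rests on \<open>b - 1 = X b z\<close>,
  \<open>z - 1 = X b\<^sup>2 z\<close> and \<open>b (b - 1) = z - 1\<close>.\<close>

lemma
  fixes W b z :: "rat fps"
  assumes "W = fps_X * b * z" "b = 1 + W" "z = 1 + W * b"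
  shows row_restricted_kernel_1:
      "b * z ^ k = 1 + fps_X * (b * z ^ Suc k + (\<Sum>i=1..k. b\<^sup>2 * z ^ i))"
    and row_restricted_kernel_2:
      "b\<^sup>2 * z ^ k = 1 + fps_X * (b * z ^ Suc k + b\<^sup>2 * z ^ Suc k + (\<Sum>i=1..k. b\<^sup>2 * z ^ i))"
    and skinny_kernel:
      "1 \<le> k \<Longrightarrow> z ^ t * b ^ k = 1 + fps_X * ((\<Sum>j=1..t. z ^ j * b ^ Suc k) +
        (z ^ Suc t * b ^ k + (\<Sum>i=1..<k. z * b ^ i)))"
proof -
  have b: "b - 1 = fps_X * b * z" using assms by simp
  have z: "z - 1 = fps_X * b * z * b" using assms by simp
  have bz: "b * (b - 1) = z - 1" unfolding b z by (simp add: mult_ac)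
  show 1: "b * z ^ k = 1 + fps_X * (b * z ^ Suc k + (\<Sum>i=1..k. b\<^sup>2 * z ^ i))" for k
  proof (induction k)
    case 0
    show ?case using b by (simp add: algebra_simps)
  next
    case (Suc k)
    have "b * z ^ Suc k - b * z ^ k = b * z ^ k * (z - 1)" by (simp add: algebra_simps)
    \<comment> \<open>One factor \<open>b\<^sup>2\<close> is split as \<open>b + b (b - 1)\<close>,
      that is \<open>b + (z - 1)\<close>: the first part yields the new column term, the second the
      change of the row term.\<close>
    also have "\<dots> = fps_X * (b * z ^ Suc k * (b + b * (b - 1)))"
      unfolding z by (simp add: algebra_simps)
    also have "\<dots> = fps_X * (b * z ^ Suc (Suc k) + (\<Sum>i=1..Suc k. b\<^sup>2 * z ^ i) -
        (b * z ^ Suc k + (\<Sum>i=1..k. b\<^sup>2 * z ^ i)))"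
      unfolding bz by (simp add: algebra_simps power2_eq_square)
    finally show ?case by (rule affine_step[OF Suc])
  qed
  show "b\<^sup>2 * z ^ k = 1 + fps_X * (b * z ^ Suc k + b\<^sup>2 * z ^ Suc k + (\<Sum>i=1..k. b\<^sup>2 * z ^ i))"
  proof (rule affine_step[OF 1[of k]])
    have "b\<^sup>2 * z ^ k - b * z ^ k = b * z ^ k * (b - 1)" by (simp add: algebra_simps power2_eq_square)
    also have "\<dots> = fps_X * (b\<^sup>2 * z ^ Suc k)"
      unfolding b by (simp add: power2_eq_square mult_ac)
    finally show "b\<^sup>2 * z ^ k - b * z ^ k = fps_X * (b * z ^ Suc k + b\<^sup>2 * z ^ Suc k +
        (\<Sum>i=1..k. b\<^sup>2 * z ^ i) - (b * z ^ Suc k + (\<Sum>i=1..k. b\<^sup>2 * z ^ i)))"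
      by simp
  qed
  \<comment> \<open>This becomes the case \<open>t = 0\<close> of the skinny identity, where only
    columns contribute.\<close>
  have 3: "b ^ k = 1 + fps_X * (\<Sum>i=1..k. z * b ^ i)" for k
  proof (induction k)
    case 0
    show ?case by simp
  next
    case (Suc k)
    have "b ^ Suc k - b ^ k = b ^ k * (b - 1)" by (simp add: algebra_simps)
    also have "\<dots> = fps_X * ((\<Sum>i=1..Suc k. z * b ^ i) - (\<Sum>i=1..k. z * b ^ i))"
      unfolding b by (simp add: mult_ac)
    finally show ?case by (rule affine_step[OF Suc])
  qed
  show "z ^ t * b ^ k = 1 + fps_X * ((\<Sum>j=1..t. z ^ j * b ^ Suc k) +
      (z ^ Suc t * b ^ k + (\<Sum>i=1..<k. z * b ^ i)))" if "1 \<le> k" for t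
  proof (induction t)
    case 0
    have "{1..k} = insert k {1..<k}" using that by auto
    then have "(\<Sum>i=1..k. z * b ^ i) = z * b ^ k + (\<Sum>i=1..<k. z * b ^ i)" by simp
    then show ?case using 3[of k] by simp
  next
    case (Suc t)
    have "z ^ Suc t * b ^ k - z ^ t * b ^ k = z ^ t * b ^ k * (z - 1)" by (simp add: algebra_simps)
    also have "\<dots> = fps_X * (z ^ Suc t * b ^ k * (b + b * (b - 1)))"
      unfolding z by (simp add: algebra_simps)
    also have "\<dots> = fps_X * ((\<Sum>j=1..Suc t. z ^ j * b ^ Suc k) +
        (z ^ Suc (Suc t) * b ^ k + (\<Sum>i=1..<k. z * b ^ i)) -
        ((\<Sum>j=1..t. z ^ j * b ^ Suc k) + (z ^ Suc t * b ^ k + (\<Sum>i=1..<k. z * b ^ i))))"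
      unfolding bz by (simp add: algebra_simps)
    finally show ?case by (rule affine_step[OF Suc])
  qed
qed

section \<open>Generating functions of the two trees\<close>

lemma sum_columns:
  fixes f :: "nat \<Rightarrow> 'a::comm_monoid_add"
  shows "(\<Sum>c\<in>{a..<n}. f (n - c)) = (\<Sum>i=1..n - a. f i)"
  by (rule sum.reindex_bij_witness[of _ "\<lambda>i. n - i" "\<lambda>c. n - c"]) auto

lemma card_words_row_restricted:
  fixes W b z :: "rat fps"
  assumes ker: "W = fps_X * b * z" "b = 1 + W" "z = 1 + W * b"
  shows "of_nat (card (words (\<lambda>_ _. 2) n)) = (b * z) $ n"
proof -
  let ?C = "\<lambda>_ _. 2 :: nat"
  define \<phi> where "\<phi> v = b ^ row_bound ?C v * z ^ (last (ups v) - last (lows v))" for v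
  have "\<phi> v = 1 + fps_X * (\<Sum>m\<in>extensions ?C v. \<phi> (m # v))" if v: "proper v" for v
  proof -
    have st: "stair (lows v) (ups v)" using stair_proper[OF v] .
    note std = stairD[OF st]
    define k where "k = last (ups v) - last (lows v)"
    define h where "h = row_bound ?C v"
    have "\<phi> (Row w # v) = b ^ w * z ^ Suc k" if "w \<in> {1..h}" for w
    proof -
      have "proper (Row w # v)" "w \<le> 2" using that v by (simp_all add: h_def row_bound_def)
      then show ?thesis
        using std(13) that
        by (simp add: \<phi>_def row_bound_Row last_raise k_def Suc_diff_le)
    qed
    then have rows: "(\<Sum>w=1..h. \<phi> (Row w # v)) = (\<Sum>w=1..h. b ^ w * z ^ Suc k)" by simp
    \<comment> \<open>A new column widens the top row to at least two, so the minimum is the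
      constant 2.\<close>
    have "row_bound ?C (Col c # v) = 2" for c
      using top_width_pos[OF std(2)] by (simp add: row_bound_def top_width_snoc)
    then have "\<phi> (Col c # v) = b\<^sup>2 * z ^ (last (ups v) - c)" for c
      by (simp add: \<phi>_def)
    then have cols: "(\<Sum>c\<in>{last (lows v)..<last (ups v)}. \<phi> (Col c # v)) = (\<Sum>i=1..k. b\<^sup>2 * z ^ i)"
      using sum_columns[of "\<lambda>i. b\<^sup>2 * z ^ i"] by (simp add: k_def)
    \<comment> \<open>The two possible labels correspond to the two row-restricted kernel
      identities.\<close>
    have "h = 1 \<or> h = 2"
      using top_width_pos[OF std(2)] by (auto simp: h_def row_bound_def)
    moreover have "{1..2::nat} = {1, 2}" by auto
    ultimately have "b ^ h * z ^ k = 1 + fps_X * ((\<Sum>w=1..h. b ^ w * z ^ Suc k) + (\<Sum>i=1..k. b\<^sup>2 * z ^ i))"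
      using row_restricted_kernel_1[OF ker, of k] row_restricted_kernel_2[OF ker, of k] by auto
    then show ?thesis
      unfolding sum_extensions h_def[symmetric] rows cols by (simp add: \<phi>_def h_def k_def)
  qed
  from card_words[of \<phi>, OF this] have "of_nat (card (words ?C n)) = \<phi> [] $ n" .
  also have "\<phi> [] = b * z"
  proof -
    have "{i. i < 1 \<and> [1 :: nat] ! i = 1} = {0}" by auto
    then show ?thesis by (simp add: \<phi>_def row_bound_def top_width_def)
  qed
  finally show ?thesis .
qed

lemma card_words_skinny:
  fixes W b z :: "rat fps"
  assumes ker: "W = fps_X * b * z" "b = 1 + W" "z = 1 + W * b"
  shows "of_nat (card (words run_length n)) = (b * z) $ n"
proof -
  let ?C = run_length
  define \<phi> where "\<phi> v = z ^ row_bound ?C v * b ^ (last (ups v) - last (lows v))" for v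
  have "\<phi> v = 1 + fps_X * (\<Sum>m\<in>extensions ?C v. \<phi> (m # v))" if v: "proper v" for v
  proof -
    have st: "stair (lows v) (ups v)" using stair_proper[OF v] .
    note std = stairD[OF st]
    define k where "k = last (ups v) - last (lows v)"
    have k: "1 \<le> k" using std(13) by (simp add: k_def)
    define t where "t = row_bound ?C v"
    have "\<phi> (Row w # v) = z ^ w * b ^ Suc k" if "w \<in> {1..t}" for w
    proof -
      have "proper (Row w # v)" "w \<le> run_length (lows v) (length (lows v))"
        using that v by (simp_all add: t_def row_bound_def)
      then show ?thesis
        using std(13) that
        by (simp add: \<phi>_def row_bound_Row last_raise k_def Suc_diff_le)
    qed
    then have rows: "(\<Sum>w=1..t. \<phi> (Row w # v)) = (\<Sum>w=1..t. z ^ w * b ^ Suc k)" by simp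
    \<comment> \<open>A column at the old bottom increases both the top width and the run length by
      one, hence also their minimum \<open>t\<close>. A higher column resets the run to 1.\<close>
    have bound: "row_bound ?C (Col c # v) = (if c = last (lows v) then Suc t else 1)"
      if "last (lows v) \<le> c" for c
      using run_length_snoc_end[OF std(1) set_le_last(1)[OF st] that] top_width_pos[OF std(2)]
      by (simp add: row_bound_def top_width_snoc t_def)
    \<comment> \<open>Starting at the old bottom is the same as having height \<open>k\<close>, so
      the exceptional child is recognised by its height and the sum can be reindexed by
      heights.\<close>
    have col: "\<phi> (Col c # v) = (if last (ups v) - c = k then z ^ Suc t * b ^ k else z * b ^ (last (ups v) - c))"
      if "c \<in> {last (lows v)..<last (ups v)}" for c
    proof -
      have "last (ups v) - c = k \<longleftrightarrow> c = last (lows v)" using that by (auto simp: k_def)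
      then show ?thesis
        using bound[of c] that by (cases "c = last (lows v)") (simp_all add: \<phi>_def k_def)
    qed
    have "(\<Sum>c\<in>{last (lows v)..<last (ups v)}. \<phi> (Col c # v)) =
        (\<Sum>i=1..k. if i = k then z ^ Suc t * b ^ k else z * b ^ i)"
      using sum_columns[of "\<lambda>i. if i = k then z ^ Suc t * b ^ k else z * b ^ i"] col
      by (simp add: k_def[symmetric])
    also have "{1..k} = insert k {1..<k}" using k by auto
    also have "(\<Sum>i\<in>insert k {1..<k}. if i = k then z ^ Suc t * b ^ k else z * b ^ i) =
        z ^ Suc t * b ^ k + (\<Sum>i=1..<k. z * b ^ i)"
      by (subst sum.insert) (auto intro!: sum.cong)
    finally have cols: "(\<Sum>c\<in>{last (lows v)..<last (ups v)}. \<phi> (Col c # v)) =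
        z ^ Suc t * b ^ k + (\<Sum>i=1..<k. z * b ^ i)" .
    show ?thesis
      unfolding sum_extensions t_def[symmetric] rows cols
      using skinny_kernel[OF ker k, of t] by (simp add: \<phi>_def t_def k_def)
  qed
  from card_words[of \<phi>, OF this] have "of_nat (card (words ?C n)) = \<phi> [] $ n" .
  also have "\<phi> [] = b * z"
  proof -
    have "{i. i < 1 \<and> [1 :: nat] ! i = 1} = {0}" "{i. i < 1 \<and> [0 :: nat] ! i = 0} = {0}" by auto
    then show ?thesis by (simp add: \<phi>_def row_bound_def top_width_def run_length_def mult.commute)
  qed
  finally show ?thesis .
qed

theorem theorem12:
  fixes n :: nat
  assumes "n \<ge> 1"
  shows "card (row_restricted_slicings 2 n) = card (zero_skinny_slicings n)"
proof -
  \<comment> \<open>The initial cell is not a move, so slicings of size \<open>n\<close> correspond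
    to words of length \<open>n - 1\<close>.\<close>
  obtain m where n: "n = Suc m" using assms by (cases n) auto
  obtain W :: "rat fps" where "W = fps_X * (1 + W) * (1 + W + W\<^sup>2)"
    by (rule fps_kernel_exists)
  \<comment> \<open>The two trivial equations instantiate \<open>b\<close> as \<open>1 + W\<close>
    and \<open>z\<close> as \<open>1 + W * (1 + W)\<close>.\<close>
  then have ker: "W = fps_X * (1 + W) * (1 + W * (1 + W))" "1 + W = 1 + W"
      "1 + W * (1 + W) = 1 + W * (1 + W)"
    by (simp_all add: algebra_simps power2_eq_square)
  have "card (row_restricted_slicings 2 n) = card (words (\<lambda>_ _. 2) m)"
    unfolding row_restricted_slicings_def n by (rule card_slicings) simp_all
  moreover have "card (zero_skinny_slicings n) = card (words run_length m)"
    unfolding zero_skinny_slicings_def n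
  proof (rule card_slicings)
    show "r_value (shape v) b = run_length (lows v) (Suc (Max (fst ` b)))"
      if "proper v" "Horizontal b \<in> blocks v" for v b
      unfolding shape_def
      by (rule r_value_region[OF stair_proper[OF that(1)] refl right_end_le[OF that]])
  qed (rule run_length_snoc)
  ultimately show ?thesis
    \<comment> \<open>Both counts are the same coefficient of \<open>b * z\<close>; they are
      compared as rationals.\<close>
    using card_words_row_restricted[OF ker, of m] card_words_skinny[OF ker, of m]
    by (simp del: of_nat_eq_iff add: of_nat_eq_iff[where 'a = rat, symmetric])
qed

end
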